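(* Let $n\ge 1$, let $\mu$ be the Haar probability measure on $SO(n)$, and let $f(x)=\int_{SO(n)}\exp(\mathrm{tr}(xy))\,\mu(dy)$ for $x=(x_{ij})\in\mathbf C^{n\times n}$ (the Fisher integral). Let $D_X=\mathbf C\langle x_{ij},\partial_{x_{ij}} : 1\le i,j\le n\rangle$ be the Weyl algebra in the $n^2$ variables $x_{ij}$. Then the annihilating ideal $\mathrm{Ann}(f)=\{p\in D_X : p\bullet f=0\}$ is generated, as a left ideal of $D_X$, by the differential operators $$\sum_{k=1}^n (x_{ki}\partial_{x_{kj}}-x_{kj}\partial_{x_{ki}}) \quad (1\leq i < j \leq n),$$ $$\delta_{ij}-\sum_{k=1}^n \partial_{x_{ki}}\partial_{x_{kj}},\qquad \delta_{ij}-\sum_{k=1}^n \partial_{x_{ik}}\partial_{x_{jk}}\quad (1\leq i\leq j \leq n),$$ $$1-\det \partial_x .$$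
   Context: $SO(n)=\{y\in\mathbf R^{n\times n} : y^\top y=e,\ \det y=1\}$, where $e$ is the identity matrix. The Haar measure $\mu$ is the unique invariant probability measure on $SO(n)$. $D_X$ is the ring of linear differential operators with complex polynomial coefficients in the variables $x_{ij}$, where $\partial_{x_{ij}}=\partial/\partial x_{ij}$; $p\bullet f$ denotes the function obtained by applying $p$ to $f$. $\delta_{ij}$ is the Kronecker symbol. $\det\partial_x$ denotes the determinant of the matrix whose $(i,j)$ entry is $\partial_{x_{ij}}$ (these entries commute). *)

theory Defs
  imports "HOL-Complex_Analysis.Cauchy_Integral_Formula"
  "HOL-Probability.Probability_Measure"
begin

section \<open>Entire functions of a matrix variable\<close>

text \<open>
  A function on complex matrices is entire if it is everywhere Frechet differentiable with a
  complex linear derivative; \<open>a\<close> is the matrix of the partial derivatives.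
\<close>

definition entire :: "(complex^'n^'n \<Rightarrow> complex) \<Rightarrow> bool" where
  "entire f \<longleftrightarrow>
     (\<forall>x. \<exists>a :: complex^'n^'n. (f has_derivative (\<lambda>h. \<Sum>i\<in>UNIV. \<Sum>j\<in>UNIV. a $ i $ j * h $ i $ j)) (at x))"

text \<open>\<open>axis i (axis j t)\<close> is the matrix with entry \<open>t\<close> at \<open>(i, j)\<close> and zeros elsewhere.\<close>

definition partial_deriv ::
    "'n \<Rightarrow> 'n \<Rightarrow> (complex^'n^'n \<Rightarrow> complex) \<Rightarrow> complex^'n^'n \<Rightarrow> complex" where
  "partial_deriv i j f x = deriv (\<lambda>t. f (x + axis i (axis j t))) 0"

lemma bounded_linear_axis2: "bounded_linear (\<lambda>t::complex. axis i (axis j t) :: complex^'n^'n)"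
proof -
  have l: "linear (\<lambda>t::complex. axis i (axis j t) :: complex^'n^'n)"
    by (rule linearI) (auto simp: vec_eq_iff axis_def)
  then show ?thesis by (simp add: linear_conv_bounded_linear)
qed

lemma sum_sum_delta:
  "(\<Sum>k\<in>UNIV. \<Sum>l\<in>UNIV. if k = i \<and> l = j then g k l else 0) = (g i j :: complex)"
  for i :: "'a :: finite" and j :: "'b :: finite"
proof -
  have "(\<Sum>k\<in>UNIV. \<Sum>l\<in>UNIV. if k = i \<and> l = j then g k l else 0)
      = (\<Sum>k\<in>UNIV. if k = i then (\<Sum>l\<in>UNIV. if l = j then g k l else 0) else 0)"
    by (rule sum.cong) auto
  then show ?thesis by simp
qed

lemma sum_axis2:
  "(\<Sum>k\<in>UNIV. \<Sum>l\<in>UNIV. a k l * (axis i (axis j t) :: complex^'n^'n) $ k $ l) = a i j * t"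
proof -
  have "a k l * (axis i (axis j t) :: complex^'n^'n) $ k $ l
      = (if k = i \<and> l = j then a k l * t else 0)" for k l
    by (simp add: axis_def)
  then show ?thesis by (simp only: sum_sum_delta)
qed

lemma has_partial_deriv:
  assumes "(f has_derivative (\<lambda>h. \<Sum>k\<in>UNIV. \<Sum>l\<in>UNIV. a $ k $ l * h $ k $ l)) (at (x + axis i (axis j t)))"
  shows "((\<lambda>t. f (x + axis i (axis j t))) has_field_derivative (a :: complex^'n^'n) $ i $ j) (at t)"
proof -
  have 1: "((\<lambda>t. x + axis i (axis j t)) has_derivative (\<lambda>t. axis i (axis j t))) (at t)"
    by (auto intro!: derivative_eq_intros bounded_linear_imp_has_derivative bounded_linear_axis2)
  show ?thesis
    using has_derivative_compose[OF 1 assms]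
    by (simp add: sum_axis2 has_field_derivative_def)
qed

lemma partial_deriv_eq:
  assumes "(f has_derivative (\<lambda>h. \<Sum>k\<in>UNIV. \<Sum>l\<in>UNIV. a $ k $ l * h $ k $ l)) (at x)"
  shows "partial_deriv i j f x = a $ i $ j"
  unfolding partial_deriv_def
  by (rule DERIV_imp_deriv, rule has_partial_deriv) (use assms in \<open>simp add: linear_0[OF bounded_linear.linear[OF bounded_linear_axis2]]\<close>)

lemma entire_has_derivative:
  assumes "entire f"
  shows "(f has_derivative (\<lambda>h. \<Sum>k\<in>UNIV. \<Sum>l\<in>UNIV. partial_deriv k l f x * h $ k $ l)) (at x)"
proof -
  obtain a where a: "(f has_derivative (\<lambda>h. \<Sum>k\<in>UNIV. \<Sum>l\<in>UNIV. a $ k $ l * h $ k $ l)) (at x)"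
    using assms unfolding entire_def by blast
  then show ?thesis by (simp add: partial_deriv_eq[OF a])
qed

lemma entireI:
  assumes "\<And>x. (f has_derivative (\<lambda>h. \<Sum>i\<in>UNIV. \<Sum>j\<in>UNIV. a x i j * h $ i $ j)) (at x)"
  shows "entire f"
  unfolding entire_def
proof
  fix x
  show "\<exists>b. (f has_derivative (\<lambda>h. \<Sum>i\<in>UNIV. \<Sum>j\<in>UNIV. b $ i $ j * h $ i $ j)) (at x)"
    by (rule exI[of _ "\<chi> i j. a x i j"]) (use assms[of x] in simp)
qed

lemma partial_deriv_eq':
  assumes "(f has_derivative (\<lambda>h. \<Sum>k\<in>UNIV. \<Sum>l\<in>UNIV. a k l * h $ k $ l)) (at x)"
  shows "partial_deriv i j f x = a i j"
  using partial_deriv_eq[of f "\<chi> i j. a i j" x i j] assms by simp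

lemma entire_continuous: "entire f \<Longrightarrow> continuous_on S f"
  by (meson continuous_at_imp_continuous_on entire_has_derivative has_derivative_continuous)

lemma has_derivative_add2:
  fixes f g :: "complex^'n^'n \<Rightarrow> complex"
  assumes "entire f" "entire g"
  shows "((\<lambda>x. f x + g x) has_derivative
     (\<lambda>h. \<Sum>k\<in>UNIV. \<Sum>l\<in>UNIV. (partial_deriv k l f x + partial_deriv k l g x) * h $ k $ l)) (at x)"
  using has_derivative_add[OF entire_has_derivative[OF assms(1)] entire_has_derivative[OF assms(2)]]
  by (simp add: sum.distrib distrib_right)

lemma has_derivative_mult2:
  fixes f g :: "complex^'n^'n \<Rightarrow> complex"
  assumes "entire f" "entire g"
  shows "((\<lambda>x. f x * g x) has_derivative
     (\<lambda>h. \<Sum>k\<in>UNIV. \<Sum>l\<in>UNIV. (f x * partial_deriv k l g x + partial_deriv k l f x * g x) * h $ k $ l)) (at x)"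
  using has_derivative_mult[OF entire_has_derivative[OF assms(1)] entire_has_derivative[OF assms(2)]]
  by (simp add: sum.distrib sum_distrib_left sum_distrib_right algebra_simps)

lemma entire_add: "entire f \<Longrightarrow> entire g \<Longrightarrow> entire (\<lambda>x. f x + g x)"
  by (rule entireI) (rule has_derivative_add2)

lemma entire_mult: "entire f \<Longrightarrow> entire g \<Longrightarrow> entire (\<lambda>x. f x * g x)"
  by (rule entireI) (rule has_derivative_mult2)

lemma partial_deriv_add:
  "entire f \<Longrightarrow> entire g \<Longrightarrow> partial_deriv i j (\<lambda>x. f x + g x) x = partial_deriv i j f x + partial_deriv i j g x"
  by (rule partial_deriv_eq'[OF has_derivative_add2])

lemma partial_deriv_mult:
  "entire f \<Longrightarrow> entire g \<Longrightarrow>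
    partial_deriv i j (\<lambda>x. f x * g x) x = f x * partial_deriv i j g x + partial_deriv i j f x * g x"
  by (rule partial_deriv_eq'[OF has_derivative_mult2])

lemma has_derivative_const2:
  "((\<lambda>_. c) has_derivative (\<lambda>h. \<Sum>k\<in>UNIV. \<Sum>l\<in>UNIV. 0 * (h :: complex^'n^'n) $ k $ l)) (at x)"
  by simp

lemma entire_const: "entire (\<lambda>_. c)"
  by (rule entireI) (rule has_derivative_const2)

lemma partial_deriv_const: "partial_deriv i j (\<lambda>_. c) x = 0"
  by (rule partial_deriv_eq'[OF has_derivative_const2])

lemma has_derivative_coord:
  "((\<lambda>x. x $ i $ j) has_derivative
     (\<lambda>h. \<Sum>k\<in>UNIV. \<Sum>l\<in>UNIV. of_bool (k = i \<and> l = j) * (h :: complex^'n^'n) $ k $ l)) (at x)"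
proof -
  have "of_bool (k = i \<and> l = j) * (h :: complex^'n^'n) $ k $ l
      = (if k = i \<and> l = j then h $ k $ l else 0)" for h k l
    by simp
  then have "(\<Sum>k\<in>UNIV. \<Sum>l\<in>UNIV. of_bool (k = i \<and> l = j) * (h :: complex^'n^'n) $ k $ l) = h $ i $ j" for h
    by (simp only: sum_sum_delta)
  moreover have "bounded_linear (\<lambda>x :: complex^'n^'n. x $ i $ j)"
    by (intro bounded_linear_compose[OF bounded_linear_vec_nth] bounded_linear_vec_nth)
  ultimately show ?thesis
    by (simp add: bounded_linear_imp_has_derivative)
qed

lemma entire_coord: "entire (\<lambda>x. x $ i $ j)"
  by (rule entireI) (rule has_derivative_coord)

lemma partial_deriv_coord: "partial_deriv k l (\<lambda>x. x $ i $ j) x = of_bool (k = i \<and> l = j)"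
  by (rule partial_deriv_eq'[OF has_derivative_coord])

subsection \<open>Partial derivatives of entire functions are entire\<close>

definition unit_circle :: "real \<Rightarrow> complex" where
  "unit_circle t = exp (2 * of_real pi * \<i> * of_real t)"

lemma unit_circle_nz: "unit_circle t \<noteq> 0"
  by (simp add: unit_circle_def)

lemma continuous_on_unit_circle [continuous_intros]:
  "continuous_on S g \<Longrightarrow> continuous_on S (\<lambda>x. unit_circle (g x))"
  unfolding unit_circle_def by (intro continuous_intros)

lemma partial_deriv_circle:
  fixes f :: "complex^'n^'n \<Rightarrow> complex"
  assumes "entire f"
  shows "partial_deriv i j f x = integral (cbox 0 1) (\<lambda>t. f (x + axis i (axis j (unit_circle t))) / unit_circle t)"
proof -
  let ?g = "\<lambda>t. f (x + axis i (axis j t))"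
  have d: "(?g has_field_derivative partial_deriv i j f (x + axis i (axis j t))) (at t)" for t
    using has_partial_deriv[of f "\<chi> k l. partial_deriv k l f (x + axis i (axis j t))" x i j t]
      entire_has_derivative[OF assms] by simp
  have hol: "?g holomorphic_on S" for S
    unfolding holomorphic_on_def field_differentiable_def
    using d has_field_derivative_at_within by blast
  have 1: "contour_integral (circlepath 0 1) (\<lambda>u. ?g u / (u - 0)^2) = (2 * pi * \<i>) * deriv ?g 0"
    by (rule Cauchy_contour_integral_circlepath_2) (auto intro: hol holomorphic_on_imp_continuous_on)
  have cp: "circlepath 0 1 t = unit_circle t"
    and vd: "vector_derivative (circlepath 0 1) (at t) = 2 * of_real pi * \<i> * unit_circle t" for t
    by (simp_all add: vector_derivative_circlepath) (simp_all add: circlepath unit_circle_def)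
  have "contour_integral (circlepath 0 1) (\<lambda>u. ?g u / (u - 0)^2)
      = integral {0..1} (\<lambda>t. (2 * pi * \<i>) * (?g (unit_circle t) / unit_circle t))"
    unfolding contour_integral_integral
    by (rule integral_cong) (simp add: cp vd power2_eq_square unit_circle_nz)
  also have "\<dots> = (2 * pi * \<i>) * integral {0..1} (\<lambda>t. ?g (unit_circle t) / unit_circle t)"
    by (rule integral_mult_right)
  finally have "deriv ?g 0 = integral {0..1} (\<lambda>t. ?g (unit_circle t) / unit_circle t)"
    unfolding 1 by simp
  then show ?thesis
    by (simp add: partial_deriv_def)
qed

lemma continuous_on_circle_shift:
  fixes f :: "complex^'n^'n \<Rightarrow> complex"
  assumes "continuous_on UNIV f"
  shows "continuous_on S (\<lambda>(x, t). f (x + axis i (axis j (unit_circle t))) / unit_circle t)"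
proof -
  have "continuous_on S (\<lambda>p. axis i (axis j (unit_circle (snd p))) :: complex^'n^'n)"
    by (rule bounded_linear.continuous_on[OF bounded_linear_axis2]) (intro continuous_intros)
  then have "continuous_on S (\<lambda>p. fst p + axis i (axis j (unit_circle (snd p))) :: complex^'n^'n)"
    by (intro continuous_intros)
  then have "continuous_on S (\<lambda>p. f (fst p + axis i (axis j (unit_circle (snd p)))))"
    by (rule continuous_on_compose2[OF assms]) auto
  then show ?thesis
    unfolding split_beta by (intro continuous_intros) (auto simp: unit_circle_nz)
qed

lemma continuous_partial_deriv:
  assumes "entire f"
  shows "continuous_on UNIV (partial_deriv i j f)"
proof -
  have "continuous_on UNIV (\<lambda>x. integral (cbox 0 1) (\<lambda>t. f (x + axis i (axis j (unit_circle t))) / unit_circle t))"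
    by (rule integral_continuous_on_param continuous_on_circle_shift)+
       (rule entire_continuous[OF assms])
  then show ?thesis
    by (subst partial_deriv_circle[OF assms, abs_def])
qed

definition blinfun_grad :: "complex^'n^'n \<Rightarrow> ((complex^'n^'n) \<Rightarrow>\<^sub>L complex)" where
  "blinfun_grad a = Blinfun (\<lambda>h. \<Sum>k\<in>UNIV. \<Sum>l\<in>UNIV. a $ k $ l * h $ k $ l)"

lemma blinfun_grad_apply:
  fixes a :: "complex^'n^'n"
  shows "blinfun_apply (blinfun_grad a) h = (\<Sum>k\<in>UNIV. \<Sum>l\<in>UNIV. a $ k $ l * h $ k $ l)"
proof -
  have "bounded_linear (\<lambda>h :: complex^'n^'n. \<Sum>k\<in>UNIV. \<Sum>l\<in>UNIV. a $ k $ l * h $ k $ l)"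
    by (intro bounded_linear_sum bounded_linear_const_mult
        bounded_linear_compose[OF bounded_linear_vec_nth] bounded_linear_vec_nth)
  then show ?thesis by (simp add: blinfun_grad_def bounded_linear_Blinfun_apply)
qed

lemma bounded_linear_blinfun_grad: "bounded_linear blinfun_grad"
proof -
  have "linear blinfun_grad"
    by (rule linearI; rule blinfun_eqI)
       (simp_all add: blinfun_grad_apply plus_blinfun.rep_eq scaleR_blinfun.rep_eq sum.distrib distrib_right
         scaleR_sum_right)
  then show ?thesis by (simp add: linear_conv_bounded_linear)
qed

lemma has_derivative_partial_deriv:
  fixes f :: "complex^'n^'n \<Rightarrow> complex"
  assumes f: "entire f"
  shows "((partial_deriv i j f) has_derivative (\<lambda>h. \<Sum>k\<in>UNIV. \<Sum>l\<in>UNIV.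
     integral (cbox 0 1) (\<lambda>t. partial_deriv k l f (x + axis i (axis j (unit_circle t))) / unit_circle t)
       * h $ k $ l)) (at x)"
proof -
  let ?s = "\<lambda>t x. x + axis i (axis j (unit_circle t)) :: complex^'n^'n"
  define G where "G = (\<lambda>x t. \<chi> k l. partial_deriv k l f (?s t x) / unit_circle t)"
  have "continuous_on UNIV (\<lambda>p. partial_deriv k l f (?s (snd p) (fst p)) / unit_circle (snd p))" for k l
    using continuous_on_circle_shift[OF continuous_partial_deriv[OF f, of k l], of UNIV i j]
    by (simp add: split_beta)
  then have cG: "continuous_on UNIV (\<lambda>(x, t). G x t)"
    unfolding G_def split_beta by (intro continuous_on_vec_lambda)
  have cb: "continuous_on UNIV (\<lambda>(x, t). blinfun_grad (G x t))"
    using bounded_linear.continuous_on[OF bounded_linear_blinfun_grad cG] by (simp add: split_beta)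
  have "((\<lambda>x. f (?s t x) / unit_circle t) has_derivative blinfun_apply (blinfun_grad (G x t))) (at x)"
    for x t
  proof -
    have 1: "(?s t has_derivative (\<lambda>h. h)) (at x)"
      by (auto intro!: derivative_eq_intros)
    have "((\<lambda>x. f (?s t x)) has_derivative
       (\<lambda>h. \<Sum>k\<in>UNIV. \<Sum>l\<in>UNIV. partial_deriv k l f (?s t x) * h $ k $ l)) (at x)"
      by (rule has_derivative_compose[OF 1 entire_has_derivative[OF f]])
    from has_derivative_mult_left[OF this, of "inverse (unit_circle t)"]
    show ?thesis
      by (simp add: blinfun_grad_apply[abs_def] G_def sum_distrib_left field_class.field_divide_inverse mult_ac)
  qed
  then have "((\<lambda>x. integral (cbox 0 1) (\<lambda>t. f (?s t x) / unit_circle t)) has_derivative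
      blinfun_apply (integral (cbox 0 1) (\<lambda>t. blinfun_grad (G x t)))) (at x within UNIV)"
  proof (intro leibniz_rule)
    show "continuous_on (UNIV \<times> cbox 0 1) (\<lambda>(x, t). blinfun_grad (G x t))"
      using cb by (rule continuous_on_subset) simp
    show "(\<lambda>t. f (?s t x) / unit_circle t) integrable_on cbox 0 1" for x
    proof (rule integrable_continuous)
      show "continuous_on (cbox 0 1) (\<lambda>t. f (?s t x) / unit_circle t)"
      proof -
        have "continuous_on (cbox 0 1) (\<lambda>t. (x, t))" by (intro continuous_intros)
        from continuous_on_compose2[OF continuous_on_circle_shift[OF entire_continuous[OF f],
              of UNIV i j] this] show ?thesis by simp
      qed
    qed
  qed auto
  moreover have "integral (cbox 0 1) (\<lambda>t. blinfun_grad (G x t)) =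
      blinfun_grad (\<chi> k l. integral (cbox 0 1) (\<lambda>t. partial_deriv k l f (?s t x) / unit_circle t))"
  proof -
    have int: "G x integrable_on cbox 0 1"
    proof (rule integrable_continuous)
      have "continuous_on (cbox 0 1) (\<lambda>t. (x, t))" by (intro continuous_intros)
      from continuous_on_compose2[OF cG this] show "continuous_on (cbox 0 1) (G x)" by simp
    qed
    have "integral (cbox 0 1) (G x) $ k $ l = integral (cbox 0 1) (\<lambda>t. G x t $ k $ l)" for k l
      using integral_linear[OF int, of "\<lambda>a. a $ k $ l"]
      by (simp add: o_def bounded_linear_compose[OF bounded_linear_vec_nth bounded_linear_vec_nth])
    then have "integral (cbox 0 1) (G x) =
        (\<chi> k l. integral (cbox 0 1) (\<lambda>t. partial_deriv k l f (?s t x) / unit_circle t))"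
      by (simp add: vec_eq_iff G_def)
    with integral_linear[OF int bounded_linear_blinfun_grad] show ?thesis
      by (simp add: o_def)
  qed
  ultimately show ?thesis
    by (subst partial_deriv_circle[OF f, abs_def]) (simp add: blinfun_grad_apply[abs_def])
qed

lemma entire_partial_deriv: "entire f \<Longrightarrow> entire (partial_deriv i j f)"
  by (rule entireI) (rule has_derivative_partial_deriv)

lemma partial_deriv_commute:
  assumes "entire f"
  shows "partial_deriv k l (partial_deriv i j f) = partial_deriv i j (partial_deriv k l f)"
  by (rule ext, rule trans[OF partial_deriv_eq'[OF has_derivative_partial_deriv[OF assms]]
       partial_deriv_circle[OF entire_partial_deriv[OF assms], symmetric]])

section \<open>The Weyl algebra\<close>

text \<open>
  The Weyl algebra in the variables \<open>x i j\<close>, realised faithfully as the algebra of linear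
  differential operators with polynomial coefficients on the space of entire functions. To make
  operators with the same action on entire functions equal, every operator maps a function that
  is not entire to zero.
\<close>

definition on_entire ::
    "((complex^'n^'n \<Rightarrow> complex) \<Rightarrow> complex^'n^'n \<Rightarrow> complex)
      \<Rightarrow> (complex^'n^'n \<Rightarrow> complex) \<Rightarrow> complex^'n^'n \<Rightarrow> complex" where
  "on_entire P f = (if entire f then P f else (\<lambda>_. 0))"

inductive_set diff_ops :: "((complex^'n^'n \<Rightarrow> complex) \<Rightarrow> complex^'n^'n \<Rightarrow> complex) set" where
  const: "on_entire (\<lambda>f x. c * f x) \<in> diff_ops"
| coord: "on_entire (\<lambda>f x. x $ i $ j * f x) \<in> diff_ops"
| partial: "on_entire (partial_deriv i j) \<in> diff_ops"
| add: "P \<in> diff_ops \<Longrightarrow> Q \<in> diff_ops \<Longrightarrow> (\<lambda>f x. P f x + Q f x) \<in> diff_ops"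
| comp: "P \<in> diff_ops \<Longrightarrow> Q \<in> diff_ops \<Longrightarrow> (\<lambda>f. P (Q f)) \<in> diff_ops"

lemma diff_ops_not_entire: "P \<in> diff_ops \<Longrightarrow> \<not> entire f \<Longrightarrow> P f = (\<lambda>_. 0)"
  and diff_ops_zero: "P \<in> diff_ops \<Longrightarrow> P (\<lambda>_. 0) = (\<lambda>_. 0)"
proof -
  have "P (\<lambda>_. 0) = (\<lambda>_. 0) \<and> (\<forall>f. \<not> entire f \<longrightarrow> P f = (\<lambda>_. 0))" if "P \<in> diff_ops"
    using that
    by induction (auto simp: on_entire_def partial_deriv_const)
  then show "P \<in> diff_ops \<Longrightarrow> \<not> entire f \<Longrightarrow> P f = (\<lambda>_. 0)"
    and "P \<in> diff_ops \<Longrightarrow> P (\<lambda>_. 0) = (\<lambda>_. 0)" by auto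
qed

lemma diff_ops_entire: "P \<in> diff_ops \<Longrightarrow> entire (P f)"
  by (induction arbitrary: f rule: diff_ops.induct)
     (auto simp: on_entire_def intro: entire_const entire_coord entire_add entire_mult entire_partial_deriv)

lemma diff_ops_add:
  assumes "P \<in> diff_ops" "entire f" "entire g"
  shows "P (\<lambda>x. f x + g x) = (\<lambda>x. P f x + P g x)"
  using assms
proof (induction arbitrary: f g rule: diff_ops.induct)
  case (comp P Q)
  then show ?case by (simp add: diff_ops_entire)
qed (auto simp: on_entire_def entire_add partial_deriv_add algebra_simps)

typedef (overloaded) 'n weyl =
  "diff_ops :: ((complex^'n::finite^'n \<Rightarrow> complex) \<Rightarrow> complex^'n^'n \<Rightarrow> complex) set"
  morphisms weyl_apply Abs_weyl
  using diff_ops.const by blast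

setup_lifting type_definition_weyl

lift_definition weyl_const :: "complex \<Rightarrow> 'n::finite weyl" is "\<lambda>c. on_entire (\<lambda>f x. c * f x)"
  by (rule diff_ops.const)

lift_definition Xop :: "'n \<Rightarrow> 'n \<Rightarrow> 'n::finite weyl" is "\<lambda>i j. on_entire (\<lambda>f x. x $ i $ j * f x)"
  by (rule diff_ops.coord)

lift_definition Dop :: "'n \<Rightarrow> 'n \<Rightarrow> 'n::finite weyl" is "\<lambda>i j. on_entire (partial_deriv i j)"
  by (rule diff_ops.partial)

instantiation weyl :: (finite) ring_1
begin

lift_definition zero_weyl :: "'a weyl" is "\<lambda>_ _. 0"
  using diff_ops.const[of 0] by (simp add: on_entire_def[abs_def])

lift_definition one_weyl :: "'a weyl" is "on_entire (\<lambda>f. f)"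
  using diff_ops.const[of 1] by simp

lift_definition plus_weyl :: "'a weyl \<Rightarrow> 'a weyl \<Rightarrow> 'a weyl" is "\<lambda>P Q f x. P f x + Q f x"
  by (rule diff_ops.add)

lift_definition uminus_weyl :: "'a weyl \<Rightarrow> 'a weyl" is "\<lambda>P f x. - P f x"
proof -
  fix P :: "(complex^'a^'a \<Rightarrow> complex) \<Rightarrow> complex^'a^'a \<Rightarrow> complex"
  assume P: "P \<in> diff_ops"
  have "(\<lambda>f x. - P f x) = (\<lambda>f. on_entire (\<lambda>f x. (-1) * f x) (P f))"
    by (auto simp: on_entire_def diff_ops_entire[OF P])
  then show "(\<lambda>f x. - P f x) \<in> diff_ops"
    using diff_ops.comp[OF diff_ops.const[of "-1"] P] by simp
qed

definition minus_weyl :: "'a weyl \<Rightarrow> 'a weyl \<Rightarrow> 'a weyl" where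
  "minus_weyl p q = p + - q"

lift_definition times_weyl :: "'a weyl \<Rightarrow> 'a weyl \<Rightarrow> 'a weyl" is "\<lambda>P Q f. P (Q f)"
  by (rule diff_ops.comp)

instance
proof
  fix a b c :: "'a weyl"
  show "a + b + c = a + (b + c)" by transfer (simp add: add.assoc)
  show "a + b = b + a" by transfer (simp add: add.commute)
  show "0 + a = a" by transfer simp
  show "- a + a = 0" by transfer simp
  show "a - b = a + - b" by (rule minus_weyl_def)
  show "a * b * c = a * (b * c)" by transfer simp
  show "1 * a = a" by transfer (simp add: on_entire_def diff_ops_entire)
  show "a * 1 = a" by transfer (auto simp: on_entire_def diff_ops_zero diff_ops_not_entire)
  show "(a + b) * c = a * c + b * c" by transfer simp
  show "a * (b + c) = a * b + a * c" by transfer (simp add: diff_ops_add diff_ops_entire)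
  have "on_entire (\<lambda>f. f) (\<lambda>_. 1) \<noteq> (\<lambda>_ :: complex^'a^'a. 0)"
    by (auto simp: on_entire_def entire_const fun_eq_iff)
  then show "(0 :: 'a weyl) \<noteq> 1" by transfer metis
qed

end

lemma weyl_eqI:
  assumes "\<And>f. entire f \<Longrightarrow> weyl_apply p f = weyl_apply q f"
  shows "p = q"
proof -
  have "weyl_apply p f = weyl_apply q f" for f
    using assms[of f] diff_ops_not_entire[OF weyl_apply, of f p] diff_ops_not_entire[OF weyl_apply, of f q]
    by (cases "entire f") auto
  then show ?thesis by (simp add: weyl_apply_inject[symmetric] fun_eq_iff)
qed

lemma entire_weyl_apply: "entire (weyl_apply p f)"
  by (rule diff_ops_entire[OF weyl_apply])

lemma weyl_apply_simps:
  assumes "entire f"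
  shows "weyl_apply (weyl_const c) f = (\<lambda>x. c * f x)"
    and "weyl_apply (Xop i j) f = (\<lambda>x. x $ i $ j * f x)"
    and "weyl_apply (Dop i j) f = partial_deriv i j f"
    and "weyl_apply 1 f = f"
  using assms
  by (simp_all add: weyl_const.rep_eq Xop.rep_eq Dop.rep_eq one_weyl.rep_eq on_entire_def)

lemma weyl_apply_ring:
  shows "weyl_apply 0 f = (\<lambda>_. 0)"
    and "weyl_apply (p + q) f = (\<lambda>x. weyl_apply p f x + weyl_apply q f x)"
    and "weyl_apply (- p) f = (\<lambda>x. - weyl_apply p f x)"
    and "weyl_apply (p - q) f = (\<lambda>x. weyl_apply p f x - weyl_apply q f x)"
    and "weyl_apply (p * q) f = weyl_apply p (weyl_apply q f)"
  by (simp_all only: zero_weyl.rep_eq plus_weyl.rep_eq uminus_weyl.rep_eq minus_weyl_def times_weyl.rep_eq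
      diff_conv_add_uminus[where 'a = complex])

lemma weyl_relations:
  shows "Xop i j * Xop k l = Xop k l * Xop i j"
    and "Dop i j * Dop k l = Dop k l * Dop i j"
    and "Dop i j * Xop k l = Xop k l * Dop i j + of_bool (i = k \<and> j = l)"
proof -
  show "Xop i j * Xop k l = Xop k l * Xop i j"
    by (rule weyl_eqI) (simp add: weyl_apply_ring weyl_apply_simps entire_mult entire_coord mult_ac)
  show "Dop i j * Dop k l = Dop k l * Dop i j"
    by (rule weyl_eqI) (simp add: weyl_apply_ring weyl_apply_simps entire_partial_deriv partial_deriv_commute)
  show "Dop i j * Xop k l = Xop k l * Dop i j + of_bool (i = k \<and> j = l)"
    by (rule weyl_eqI)
       (simp add: weyl_apply_ring weyl_apply_simps entire_mult entire_coord entire_partial_deriv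
         partial_deriv_mult partial_deriv_coord of_bool_def algebra_simps fun_eq_iff)
qed

text \<open>
  The Leibniz expansion of the determinant of the matrix \<open>(Dop i j)\<close>. The factors commute, so the
  order chosen to write the product in the noncommutative ring is immaterial.
\<close>

definition det_Dop :: "'n::{finite, linorder} weyl" where
  "det_Dop = (\<Sum>p | p permutes (UNIV :: 'n set).
     of_int (sign p) * prod_list (map (\<lambda>i. Dop i (p i)) (sorted_list_of_set UNIV)))"

definition left_ideal :: "'a::ring_1 set \<Rightarrow> bool" where
  "left_ideal I \<longleftrightarrow> 0 \<in> I \<and> (\<forall>a\<in>I. \<forall>b\<in>I. a + b \<in> I) \<and> (\<forall>r. \<forall>a\<in>I. r * a \<in> I)"

text \<open>
  Only meaningful for entire functions, as operators send other functions to zero; that the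
  Fisher integral is entire is shown below.
\<close>

definition annihilator :: "(complex^'n^'n \<Rightarrow> complex) \<Rightarrow> 'n::finite weyl set" where
  "annihilator f = {p. weyl_apply p f = (\<lambda>_. 0)}"

section \<open>The Fisher integral\<close>

definition special_orthogonal :: "(real^'n^'n) set" where
  "special_orthogonal = {y. transpose y ** y = mat 1 \<and> det y = 1}"

text \<open>
  Left invariance suffices to characterise the Haar probability measure uniquely and implies
  right invariance, since the group is compact.
\<close>

definition haar_probability :: "(real^'n^'n) measure \<Rightarrow> bool" where
  "haar_probability \<mu> \<longleftrightarrow>
     prob_space \<mu> \<and> sets \<mu> = sets (restrict_space borel special_orthogonal) \<and>
     (\<forall>g\<in>special_orthogonal. distr \<mu> \<mu> (\<lambda>y. g ** y) = \<mu>)"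

definition fisher_integral :: "(real^'n^'n) measure \<Rightarrow> complex^'n^'n \<Rightarrow> complex" where
  "fisher_integral \<mu> x = (\<integral>y. exp (trace (x ** map_matrix complex_of_real y)) \<partial>\<mu>)"

lemma special_orthogonal_entry_le:
  assumes "y \<in> special_orthogonal"
  shows "\<bar>y $ k $ i\<bar> \<le> 1"
proof -
  have "(transpose y ** y) $ i $ i = 1"
    using assms by (simp add: special_orthogonal_def mat_def)
  then have 1: "(\<Sum>k\<in>UNIV. (y $ k $ i)\<^sup>2) = 1"
    by (simp add: matrix_matrix_mult_def transpose_def power2_eq_square)
  have "(y $ k $ i)\<^sup>2 \<le> (\<Sum>k\<in>UNIV. (y $ k $ i)\<^sup>2)"
    by (rule member_le_sum) auto
  then show ?thesis using 1 by (simp add: abs_square_le_1)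
qed

lemma trace_map_matrix:
  "trace (x ** map_matrix complex_of_real y) = (\<Sum>i\<in>UNIV. \<Sum>k\<in>UNIV. of_real (y $ k $ i) * x $ i $ k)"
  by (simp add: trace_def matrix_matrix_mult_def mult.commute)

lemma norm_trace_le:
  fixes x :: "complex^'n^'n"
  assumes "y \<in> special_orthogonal"
  shows "norm (trace (x ** map_matrix complex_of_real y)) \<le> (real CARD('n))\<^sup>2 * norm x"
proof -
  have "norm (complex_of_real (y $ k $ i) * x $ i $ k) \<le> norm x" for i k
  proof -
    have "norm (complex_of_real (y $ k $ i) * x $ i $ k) \<le> 1 * norm (x $ i $ k)"
      unfolding norm_mult
      by (rule mult_right_mono) (use special_orthogonal_entry_le[OF assms] in auto)
    also have "\<dots> \<le> norm x"
      using Finite_Cartesian_Product.norm_nth_le[of "x $ i" k] Finite_Cartesian_Product.norm_nth_le[of x i] by linarith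
    finally show ?thesis .
  qed
  then have row: "norm (\<Sum>k\<in>UNIV. complex_of_real (y $ k $ i) * x $ i $ k) \<le> of_nat CARD('n) * norm x" for i
    by (intro sum_norm_bound) auto
  have "norm (\<Sum>i\<in>UNIV. \<Sum>k\<in>UNIV. complex_of_real (y $ k $ i) * x $ i $ k)
      \<le> of_nat CARD('n) * (of_nat CARD('n) * norm x)"
    by (rule sum_norm_bound) (rule row)
  then show ?thesis by (simp add: trace_map_matrix power2_eq_square mult_ac)
qed

lemma norm_exp_remainder: "norm (exp z - 1 - z) \<le> exp (norm z) * (norm z)\<^sup>2" for z :: complex
proof -
  have "norm (exp z - (\<Sum>k\<le>1. z ^ k / fact k)) \<le> exp \<bar>Re z\<bar> * norm z ^ Suc 1 / fact 1"
    by (rule Taylor_exp)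
  also have "\<dots> \<le> exp (norm z) * (norm z)\<^sup>2"
    by (simp add: abs_Re_le_cmod mult_right_mono power2_eq_square)
  finally show ?thesis by (simp add: diff_diff_eq)
qed

lemma haar_integrable:
  fixes g :: "real^'n^'n \<Rightarrow> complex"
  assumes "haar_probability \<mu>" "continuous_on UNIV g" "\<And>y. y \<in> special_orthogonal \<Longrightarrow> norm (g y) \<le> B"
  shows "integrable \<mu> g"
proof -
  interpret prob_space \<mu> using assms(1) by (simp add: haar_probability_def)
  have sets: "sets \<mu> = sets (restrict_space borel special_orthogonal)"
    using assms(1) by (simp add: haar_probability_def)
  have "g \<in> borel_measurable (restrict_space borel special_orthogonal)"
    by (rule measurable_restrict_space1) (rule borel_measurable_continuous_onI[OF assms(2)])
  then have "g \<in> borel_measurable \<mu>"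
    using measurable_cong_sets[OF sets refl] by blast
  moreover have "space \<mu> = special_orthogonal"
    using sets_eq_imp_space_eq[OF sets] by (simp add: space_restrict_space)
  ultimately show ?thesis
    by (intro integrable_const_bound[of _ B]) (auto simp: assms(3))
qed

lemma continuous_on_trace: "continuous_on S (\<lambda>y. trace (x ** map_matrix complex_of_real y))"
  unfolding trace_map_matrix by (intro continuous_intros)

lemma entire_fisher_integral:
  fixes \<mu> :: "(real^'n^'n) measure"
  assumes \<mu>: "haar_probability \<mu>"
  shows "entire (fisher_integral \<mu>)"
proof -
  interpret prob_space \<mu> using \<mu> by (simp add: haar_probability_def)
  define C where "C = (real CARD('n))\<^sup>2"
  define L where "L = (\<lambda>(x :: complex^'n^'n) y. trace (x ** map_matrix complex_of_real y))"
  have C: "C \<ge> 0" by (simp add: C_def)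
  have fisher: "fisher_integral \<mu> x = (\<integral>y. exp (L x y) \<partial>\<mu>)" for x
    by (simp add: fisher_integral_def L_def)
  have L_add: "L (x + h) y = L x y + L h y" for x h y
    by (simp add: L_def trace_map_matrix distrib_left sum.distrib)
  have L_le: "norm (L x y) \<le> C * norm x" if "y \<in> special_orthogonal" for x y
    using norm_trace_le[OF that] by (simp add: L_def C_def)
  have L_cont [continuous_intros]: "continuous_on S (L x)" for S x
    unfolding L_def by (rule continuous_on_trace)
  have space: "space \<mu> = special_orthogonal"
    using \<mu> sets_eq_imp_space_eq[of \<mu> "restrict_space borel special_orthogonal"]
    by (simp add: haar_probability_def space_restrict_space)
  have exp_le: "norm (exp (L x y)) \<le> exp (C * norm x)" if "y \<in> special_orthogonal" for x y
    using norm_exp[of "L x y"] L_le[OF that, of x] by (meson exp_le_cancel_iff order_trans)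
  have int_exp: "integrable \<mu> (\<lambda>y. exp (L x y))" for x
    by (rule haar_integrable[OF \<mu> _ exp_le]) (intro continuous_intros)
  have int_entry: "integrable \<mu> (\<lambda>y. exp (L x y) * of_real (y $ k $ i))" for x i k
  proof (rule haar_integrable[OF \<mu>])
    show "norm (exp (L x y) * complex_of_real (y $ k $ i)) \<le> exp (C * norm x) * 1"
      if "y \<in> special_orthogonal" for y
      unfolding norm_mult using exp_le[OF that] special_orthogonal_entry_le[OF that, of k i]
      by (intro mult_mono) auto
  qed (intro continuous_intros)
  define a where "a = (\<lambda>x i k. \<integral>y. exp (L x y) * of_real (y $ k $ i) \<partial>\<mu>)"
  have lin: "(\<Sum>i\<in>UNIV. \<Sum>k\<in>UNIV. a x i k * h $ i $ k) = (\<integral>y. exp (L x y) * L h y \<partial>\<mu>)"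
    and int_lin: "integrable \<mu> (\<lambda>y. exp (L x y) * L h y)" for x h
  proof -
    have eq: "exp (L x y) * L h y =
        (\<Sum>i\<in>UNIV. \<Sum>k\<in>UNIV. (exp (L x y) * of_real (y $ k $ i)) * h $ i $ k)" for y
      by (simp add: L_def trace_map_matrix sum_distrib_left sum_distrib_right mult_ac)
    show "integrable \<mu> (\<lambda>y. exp (L x y) * L h y)"
      unfolding eq by (intro Bochner_Integration.integrable_sum integrable_mult_left int_entry)
    show "(\<Sum>i\<in>UNIV. \<Sum>k\<in>UNIV. a x i k * h $ i $ k) = (\<integral>y. exp (L x y) * L h y \<partial>\<mu>)"
      unfolding eq a_def
      by (simp only: Bochner_Integration.integral_sum Bochner_Integration.integrable_sum integrable_mult_left int_entry
          integral_mult_left_zero)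
  qed
  show ?thesis
  proof (rule entireI)
    fix x :: "complex^'n^'n"
    define K where "K = exp (C * norm x) * (exp C * C\<^sup>2)"
    show "(fisher_integral \<mu> has_derivative (\<lambda>h. \<Sum>i\<in>UNIV. \<Sum>k\<in>UNIV. a x i k * h $ i $ k)) (at x)"
    proof (rule has_derivativeI_sandwich[of 1])
      show "bounded_linear (\<lambda>h :: complex^'n^'n. \<Sum>i\<in>UNIV. \<Sum>k\<in>UNIV. a x i k * h $ i $ k)"
        by (intro bounded_linear_sum bounded_linear_const_mult
            bounded_linear_compose[OF bounded_linear_vec_nth] bounded_linear_vec_nth)
      show "((\<lambda>z. K * norm (z - x)) \<longlongrightarrow> 0) (at x)"
        by (auto intro!: tendsto_eq_intros)
      fix z assume z: "z \<noteq> x" "dist z x < 1"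
      define h where "h = z - x"
      have zh: "z = x + h" and h: "norm h \<le> 1" "norm h > 0"
        using z by (auto simp: h_def dist_norm)
      have bound: "norm (exp (L z y) - exp (L x y) - exp (L x y) * L h y) \<le> K * (norm h)\<^sup>2"
        if y: "y \<in> special_orthogonal" for y
      proof -
        have "norm (L h y) \<le> C"
          using L_le[OF y, of h] h C mult_left_mono[of "norm h" 1 C] by linarith
        have "norm (exp (L h y) - 1 - L h y) \<le> exp (norm (L h y)) * (norm (L h y))\<^sup>2"
          by (rule norm_exp_remainder)
        also have "\<dots> \<le> exp C * (C * norm h)\<^sup>2"
          using \<open>norm (L h y) \<le> C\<close> L_le[OF y, of h] by (intro mult_mono power_mono) auto
        finally have "norm (exp (L x y)) * norm (exp (L h y) - 1 - L h y)
            \<le> exp (C * norm x) * (exp C * (C * norm h)\<^sup>2)"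
          by (intro mult_mono exp_le y) auto
        moreover have "exp (L z y) - exp (L x y) - exp (L x y) * L h y
            = exp (L x y) * (exp (L h y) - 1 - L h y)"
          by (simp add: zh L_add exp_add algebra_simps)
        ultimately show ?thesis
          by (simp add: norm_mult K_def power_mult_distrib mult_ac)
      qed
      have "norm (\<integral>y. exp (L z y) - exp (L x y) - exp (L x y) * L h y \<partial>\<mu>) \<le> K * (norm h)\<^sup>2"
      proof -
        have "norm (\<integral>y. exp (L z y) - exp (L x y) - exp (L x y) * L h y \<partial>\<mu>)
            \<le> (\<integral>y. K * (norm h)\<^sup>2 \<partial>\<mu>)"
          by (intro Bochner_Integration.integral_norm_bound_integral Bochner_Integration.integrable_diff
              int_exp int_lin integrable_const) (use bound space in auto)
        then show ?thesis by (simp add: prob_space)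
      qed
      moreover have "(\<integral>y. exp (L z y) - exp (L x y) - exp (L x y) * L h y \<partial>\<mu>)
          = fisher_integral \<mu> z - fisher_integral \<mu> x - (\<Sum>i\<in>UNIV. \<Sum>k\<in>UNIV. a x i k * h $ i $ k)"
        unfolding lin
        by (simp add: fisher Bochner_Integration.integral_diff int_exp int_lin
            Bochner_Integration.integrable_diff)
      ultimately have "norm (fisher_integral \<mu> z - fisher_integral \<mu> x
          - (\<Sum>i\<in>UNIV. \<Sum>k\<in>UNIV. a x i k * h $ i $ k)) \<le> K * norm h * norm h"
        by (simp only: power2_eq_square mult.assoc)
      then show "norm (fisher_integral \<mu> z - fisher_integral \<mu> x
          - (\<Sum>i\<in>UNIV. \<Sum>k\<in>UNIV. a x i k * (z - x) $ i $ k)) / norm (z - x) \<le> K * norm (z - x)"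
        using h(2) unfolding h_def[symmetric] by (simp only: pos_divide_le_eq)
    qed simp
  qed
qed

end

theory Submission
  imports Defs
begin

text \<open>
  On \<open>exp (trace (x ** y))\<close> an operator with constant coefficients acts as multiplication by a polynomial in
  \<open>y\<close>, so such an operator annihilates the Fisher integral iff this polynomial vanishes on the group:
  integrate it against its complex conjugate. A general operator is reduced to this case by commuting it
  with the operators \<open>\<delta>\<^sub>i\<^sub>j - (\<Sum>k. \<partial>\<^sub>k\<^sub>i \<partial>\<^sub>k\<^sub>j)\<close>, which lowers the degree in \<open>x\<close>; modulo the left ideal, its
  leading part can be recovered from these commutators by an Euler operator.

  It remains to see that a polynomial vanishing on the real group lies in the ideal generated by the
  orthogonality relations and \<open>det w - 1\<close>. In the Cayley chart \<open>det (1 + w) \<noteq> 0\<close> this holds because there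
  is a rational retraction of all matrices onto the group that is the identity modulo the ideal, so that the
  polynomial times a power of \<open>det (1 + w)\<close> lies in the ideal. Finitely many translates of
  \<open>det (1 + w)\<close> by diagonal sign matrices generate the unit ideal.
\<close>

section \<open>Constant coefficient operators and their symbols\<close>

text \<open>In the reduction each family of generators has its own task. Commutators with the column
  relations differentiate along the normal directions; the rotations make the skew part of x^T d/dx
  negligible modulo the ideal, which disposes of the tangential directions; the row relations
  contract the derivatives that the commutators produce, giving the coordinate back. Together every
  coordinate factor contributes -2, and in characteristic zero this can be divided out. For the
  polynomials the obstacle is that only real points of the group are at hand, while the ideal must
  be shown to contain everything that vanishes there. The retraction moves the question to the space
  of all matrices: the pulled back polynomial vanishes at every real matrix outside the zeros of the
  denominator, and a polynomial that vanishes at all real matrices is zero. So neither the density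
  of the real group in the complex one nor the radicality of the ideal has to be known in
  advance.\<close>

lemma weyl_const_simps:
  "weyl_const c * weyl_const d = weyl_const (c * d)"
  "weyl_const c + weyl_const d = weyl_const (c + d)"
  "weyl_const 0 = 0" "weyl_const 1 = 1" "- weyl_const c = weyl_const (- c)"
  by (rule weyl_eqI; simp add: weyl_apply_ring weyl_apply_simps entire_mult entire_const algebra_simps)+

lemma weyl_const_of_nat: "weyl_const (of_nat k) = of_nat k"
  by (induction k) (simp_all add: weyl_const_simps flip: weyl_const_simps(2))

lemma weyl_const_commute:
  "weyl_const c * Xop i j = Xop i j * weyl_const c"
  "Dop i j * weyl_const c = weyl_const c * Dop i j"
  by (rule weyl_eqI; simp add: weyl_apply_ring weyl_apply_simps entire_mult entire_const entire_coord
      entire_partial_deriv partial_deriv_mult partial_deriv_const mult_ac fun_eq_iff)+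

lemma weyl_induct [case_names const X D add mult]:
  assumes "\<And>c. P (weyl_const c)" "\<And>i j. P (Xop i j)" "\<And>i j. P (Dop i j)"
    and "\<And>p q. P p \<Longrightarrow> P q \<Longrightarrow> P (p + q)" "\<And>p q. P p \<Longrightarrow> P q \<Longrightarrow> P (p * q)"
  shows "P (p :: 'n::finite weyl)"
proof -
  have "P (Abs_weyl F)" if "F \<in> diff_ops" for F :: "(complex^'n^'n \<Rightarrow> complex) \<Rightarrow> complex^'n^'n \<Rightarrow> complex"
    using that
  proof (induction rule: diff_ops.induct)
    case (const c) then show ?case using assms(1) by (simp add: weyl_const_def)
  next
    case (coord i j) then show ?case using assms(2) by (simp add: Xop_def)
  next
    case (partial i j) then show ?case using assms(3) by (simp add: Dop_def)
  next
    case (add F G)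
    then have "Abs_weyl (\<lambda>f x. F f x + G f x) = Abs_weyl F + Abs_weyl G"
      by (simp add: plus_weyl.abs_eq eq_onp_def)
    with add assms(4) show ?case by simp
  next
    case (comp F G)
    then have "Abs_weyl (\<lambda>f. F (G f)) = Abs_weyl F * Abs_weyl G"
      by (simp add: times_weyl.abs_eq eq_onp_def)
    with comp assms(5) show ?case by simp
  qed
  from this[OF weyl_apply[of p]] show ?thesis by (simp add: weyl_apply_inverse)
qed

text \<open>Operator and symbol are generated side by side, so no normal form has to be chosen. That
  the symbol determines the operator is \<open>has_symbol_inject\<close>.\<close>

inductive has_symbol :: "'n::finite weyl \<Rightarrow> (complex^'n^'n \<Rightarrow> complex) \<Rightarrow> bool" where
  const: "has_symbol (weyl_const c) (\<lambda>_. c)"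
| D: "has_symbol (Dop i j) (\<lambda>w. w $ i $ j)"
| add: "has_symbol r g \<Longrightarrow> has_symbol s h \<Longrightarrow> has_symbol (r + s) (\<lambda>w. g w + h w)"
| mult: "has_symbol r g \<Longrightarrow> has_symbol s h \<Longrightarrow> has_symbol (r * s) (\<lambda>w. g w * h w)"

lemma has_symbol_0: "has_symbol 0 (\<lambda>_. 0)" and has_symbol_1: "has_symbol 1 (\<lambda>_. 1)"
  using has_symbol.const[of 0] has_symbol.const[of 1] by (simp_all add: weyl_const_simps)

lemma has_symbol_minus: "has_symbol r g \<Longrightarrow> has_symbol (- r) (\<lambda>w. - g w)"
proof -
  assume "has_symbol r g"
  from has_symbol.mult[OF has_symbol.const[of "-1"] this]
  show ?thesis by (simp add: weyl_const_simps flip: weyl_const_simps(5))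
qed

lemma has_symbol_diff: "has_symbol r g \<Longrightarrow> has_symbol s h \<Longrightarrow> has_symbol (r - s) (\<lambda>w. g w - h w)"
  using has_symbol.add[OF _ has_symbol_minus, of r g s h] by simp

lemma has_symbol_of_bool: "has_symbol (of_bool P) (\<lambda>_. of_bool P)"
  by (cases P) (simp_all add: has_symbol_0 has_symbol_1)

lemma has_symbol_sum:
  "(\<And>k. k \<in> A \<Longrightarrow> has_symbol (r k) (g k)) \<Longrightarrow> has_symbol (\<Sum>k\<in>A. r k) (\<lambda>w. \<Sum>k\<in>A. g k w)"
  by (induction A rule: infinite_finite_induct) (auto intro: has_symbol_0 has_symbol.add)

lemma has_symbol_prod_list:
  "(\<And>k. k \<in> set ks \<Longrightarrow> has_symbol (r k) (g k)) \<Longrightarrow>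
    has_symbol (prod_list (map r ks)) (\<lambda>w. prod_list (map (\<lambda>k. g k w) ks))"
  by (induction ks) (auto intro: has_symbol_1 has_symbol.mult)

lemma has_symbol_of_int: "has_symbol (of_int m) (\<lambda>_. of_int m)"
proof -
  have nat: "has_symbol (of_nat k) (\<lambda>_. of_nat k)" for k
    using has_symbol.const[of "of_nat k"] by (simp add: weyl_const_of_nat)
  show ?thesis
    by (cases m rule: int_diff_cases) (use has_symbol_diff[OF nat nat] in simp)
qed

lemmas has_symbol_intros = has_symbol.intros has_symbol_0 has_symbol_1 has_symbol_minus has_symbol_diff
  has_symbol_of_bool has_symbol_sum has_symbol_prod_list has_symbol_of_int

lemma has_symbol_D_commute: "has_symbol r g \<Longrightarrow> Dop i j * r = r * Dop i j"
proof (induction rule: has_symbol.induct)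
  case (mult r g s h)
  then show ?case by (metis mult.assoc)
qed (auto simp: weyl_const_commute weyl_relations(2) algebra_simps)

lemma has_symbol_commute:
  assumes "has_symbol r g" "has_symbol s h"
  shows "r * s = s * r"
  using assms(2)
proof (induction rule: has_symbol.induct)
  case (const c)
  from assms(1) show ?case
  proof (induction rule: has_symbol.induct)
    case (mult r g s h)
    then show ?case by (metis mult.assoc)
  qed (auto simp: weyl_const_commute weyl_const_simps algebra_simps)
next
  case (mult s g s' h)
  then show ?case by (metis mult.assoc)
qed (auto simp: has_symbol_D_commute[OF assms(1)] algebra_simps)

text \<open>Commuting with a coordinate differentiates the symbol with respect to the matching
  entry, so no coordinate survives.\<close>

lemma has_symbol_X_commutator:
  assumes "has_symbol r g"
  shows "\<exists>h. has_symbol (r * Xop i j - Xop i j * r) h"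
  using assms
proof (induction rule: has_symbol.induct)
  case (const c)
  then show ?case using has_symbol_0 by (auto simp: weyl_const_commute)
next
  case (D k l)
  have "Dop k l * Xop i j - Xop i j * Dop k l = of_bool (k = i \<and> l = j)"
    by (simp add: weyl_relations(3))
  then show ?case using has_symbol_of_bool by metis
next
  case (add r g s h)
  have "(r + s) * Xop i j - Xop i j * (r + s)
      = (r * Xop i j - Xop i j * r) + (s * Xop i j - Xop i j * s)" by (simp add: algebra_simps)
  with add.IH show ?case by (auto intro: has_symbol.add)
next
  case (mult r g s h)
  have "r * s * Xop i j - Xop i j * (r * s)
      = r * (s * Xop i j - Xop i j * s) + (r * Xop i j - Xop i j * r) * s" by (simp add: algebra_simps)
  with mult show ?case by (auto intro: has_symbol.add has_symbol.mult)
qed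

section \<open>Filtration by the degree in the coordinates\<close>

text \<open>Level \<open>d\<close> means degree in the coordinates below \<open>d\<close>, with the
  coordinates written on the left. The shift by one makes level 0 trivial, so that lowering the
  degree of a constant coefficient operator gives zero.\<close>

inductive X_filtration :: "nat \<Rightarrow> 'n::finite weyl \<Rightarrow> bool" where
  zero: "X_filtration d 0"
| symbol: "has_symbol r g \<Longrightarrow> X_filtration (Suc d) r"
| X: "X_filtration d a \<Longrightarrow> X_filtration (Suc d) (Xop i j * a)"
| add: "X_filtration d a \<Longrightarrow> X_filtration d b \<Longrightarrow> X_filtration d (a + b)"

lemma X_filtration_0: "X_filtration 0 a \<Longrightarrow> a = 0"
proof -
  have "X_filtration d a \<Longrightarrow> d = 0 \<Longrightarrow> a = 0" for d
    by (induction rule: X_filtration.induct) auto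
  then show "X_filtration 0 a \<Longrightarrow> a = 0" by auto
qed

lemma X_filtration_Suc: "X_filtration d a \<Longrightarrow> X_filtration (Suc d) a"
  by (induction rule: X_filtration.induct) (auto intro: X_filtration.intros)

lemma X_filtration_mono: "X_filtration d a \<Longrightarrow> d \<le> e \<Longrightarrow> X_filtration e a"
  by (induction e) (auto simp: le_Suc_eq intro: X_filtration_Suc)

lemma X_filtration_const: "X_filtration d a \<Longrightarrow> X_filtration d (weyl_const c * a)"
proof (induction rule: X_filtration.induct)
  case (X d a i j)
  have "weyl_const c * (Xop i j * a) = Xop i j * (weyl_const c * a)"
    by (simp add: weyl_const_commute flip: mult.assoc)
  with X show ?case by (simp add: X_filtration.X)
qed (auto simp: distrib_left intro: X_filtration.intros has_symbol.intros)

lemma X_filtration_minus: "X_filtration d a \<Longrightarrow> X_filtration d (- a)"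
  using X_filtration_const[of d a "-1"] by (simp add: weyl_const_simps flip: weyl_const_simps(5))

lemma X_filtration_diff: "X_filtration d a \<Longrightarrow> X_filtration d b \<Longrightarrow> X_filtration d (a - b)"
  using X_filtration.add[OF _ X_filtration_minus, of d a b] by simp

lemma X_filtration_of_bool: "X_filtration d a \<Longrightarrow> X_filtration d (of_bool P * a)"
  by (cases P) (auto intro: X_filtration.zero)

lemma X_filtration_sum: "(\<And>k. k \<in> A \<Longrightarrow> X_filtration d (a k)) \<Longrightarrow> X_filtration d (\<Sum>k\<in>A. a k)"
  by (induction A rule: infinite_finite_induct) (auto intro: X_filtration.intros)

lemma X_filtration_D: "X_filtration d a \<Longrightarrow> X_filtration d (Dop i j * a)"
proof (induction rule: X_filtration.induct)
  case (X d a k l)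
  have "Dop i j * (Xop k l * a) = Xop k l * (Dop i j * a) + of_bool (i = k \<and> j = l) * a"
    by (simp only: mult.assoc[symmetric] weyl_relations(3)) (simp add: distrib_right mult.assoc)
  with X show ?case by (metis X_filtration.add X_filtration.X X_filtration_of_bool X_filtration_Suc)
qed (auto simp: distrib_left intro: X_filtration.intros has_symbol.intros)

lemma X_filtration_symbol_left:
  "has_symbol r g \<Longrightarrow> X_filtration d a \<Longrightarrow> X_filtration d (r * a)"
  by (induction arbitrary: a rule: has_symbol.induct)
     (auto simp: distrib_right mult.assoc intro: X_filtration_const X_filtration_D X_filtration.add)

lemma X_filtration_symbol_right:
  assumes "has_symbol s h"
  shows "X_filtration d a \<Longrightarrow> X_filtration d (a * s)"
  by (induction rule: X_filtration.induct)
     (use assms in \<open>auto simp: distrib_right mult.assoc intro: X_filtration.intros has_symbol.mult\<close>)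

text \<open>Commuting with \<open>Dop i j\<close> differentiates the coefficients with respect to
  \<open>x i j\<close>.\<close>

lemma X_filtration_D_commutator:
  "X_filtration d a \<Longrightarrow> X_filtration (d - 1) (Dop i j * a - a * Dop i j)"
proof (induction rule: X_filtration.induct)
  case (symbol r g d)
  then show ?case by (simp add: has_symbol_D_commute X_filtration.zero)
next
  case (X d a k l)
  have "Dop i j * (Xop k l * a) - Xop k l * a * Dop i j
      = Xop k l * (Dop i j * a - a * Dop i j) + of_bool (i = k \<and> j = l) * a"
    by (simp only: mult.assoc[symmetric] weyl_relations(3))
       (simp add: distrib_right mult.assoc right_diff_distrib)
  moreover have "X_filtration d (Xop k l * (Dop i j * a - a * Dop i j))"
  \<comment> \<open>For \<open>d = 0\<close> the subtraction in the induction hypothesis truncates,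
    but then \<open>a\<close> is zero.\<close>
  proof (cases d)
    case 0
    then show ?thesis using X_filtration_0[of a] X by (simp add: X_filtration.zero)
  next
    case (Suc e)
    with X show ?thesis by (auto intro: X_filtration.X)
  qed
  ultimately show ?case using X by (auto intro: X_filtration.add X_filtration_of_bool)
next
  case (add d a b)
  have "Dop i j * (a + b) - (a + b) * Dop i j
      = (Dop i j * a - a * Dop i j) + (Dop i j * b - b * Dop i j)" by (simp add: algebra_simps)
  with add show ?case by (metis X_filtration.add)
qed (auto intro: X_filtration.zero)

lemma X_filtration_commutator:
  assumes "has_symbol r g" "X_filtration d a"
  shows "X_filtration (d - 1) (r * a - a * r)"
  using assms(1)
proof (induction rule: has_symbol.induct)
  case (const c)
  from assms(2) have "weyl_const c * a = a * weyl_const c"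
  proof (induction rule: X_filtration.induct)
    case (symbol r g d)
    then show ?case using has_symbol_commute has_symbol.const by blast
  next
    case (X d a i j)
    then show ?case by (metis weyl_const_commute(1) mult.assoc)
  qed (auto simp: algebra_simps)
  then show ?case by (simp add: X_filtration.zero)
next
  case (D i j)
  then show ?case using assms(2) by (rule X_filtration_D_commutator)
next
  case (add r g s h)
  have "(r + s) * a - a * (r + s) = (r * a - a * r) + (s * a - a * s)" by (simp add: algebra_simps)
  with add show ?case by (metis X_filtration.add)
next
  case (mult r g s h)
  have "r * s * a - a * (r * s) = r * (s * a - a * s) + (r * a - a * r) * s" by (simp add: algebra_simps)
  with mult show ?case
    by (metis X_filtration.add X_filtration_symbol_left X_filtration_symbol_right)
qed

text \<open>Differentiating a coefficient loses a coordinate, which the factor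
  \<open>Xop k l\<close> replaces; moving \<open>Xop k l\<close> past a symbol creates none.\<close>

lemma X_filtration_vector_field_commutator:
  "X_filtration d a \<Longrightarrow> X_filtration d (Xop k l * Dop i j * a - a * (Xop k l * Dop i j))"
proof (induction rule: X_filtration.induct)
  case (symbol r g d)
  obtain h where h: "has_symbol (r * Xop k l - Xop k l * r) h"
    using has_symbol_X_commutator[OF symbol] by blast
  have "Xop k l * Dop i j * r - r * (Xop k l * Dop i j) = - ((r * Xop k l - Xop k l * r) * Dop i j)"
    by (simp add: mult.assoc has_symbol_D_commute[OF symbol] algebra_simps)
  then show ?case
    using X_filtration.symbol[OF has_symbol_minus[OF has_symbol.mult[OF h has_symbol.D]]] by metis
next
  case (X d a i' j')
  have "Xop k l * Dop i j * (Xop i' j' * a) = Xop k l * (Dop i j * Xop i' j') * a"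
    by (simp add: mult.assoc)
  also have "\<dots> = Xop k l * Xop i' j' * Dop i j * a + Xop k l * (of_bool (i = i' \<and> j = j') * a)"
    by (simp add: weyl_relations(3) algebra_simps)
  also have "\<dots> = Xop i' j' * (Xop k l * Dop i j * a) + Xop k l * (of_bool (i = i' \<and> j = j') * a)"
    by (simp add: weyl_relations(1)[of k l] mult.assoc)
  finally have "Xop k l * Dop i j * (Xop i' j' * a) - Xop i' j' * a * (Xop k l * Dop i j)
      = Xop i' j' * (Xop k l * Dop i j * a - a * (Xop k l * Dop i j)) + Xop k l * (of_bool (i = i' \<and> j = j') * a)"
    by (simp add: algebra_simps)
  with X show ?case
    by (auto intro: X_filtration.add X_filtration.X X_filtration_of_bool)
next
  case (add d a b)
  have "Xop k l * Dop i j * (a + b) - (a + b) * (Xop k l * Dop i j)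
      = (Xop k l * Dop i j * a - a * (Xop k l * Dop i j)) + (Xop k l * Dop i j * b - b * (Xop k l * Dop i j))"
    by (simp add: algebra_simps)
  with add show ?case by (metis X_filtration.add)
qed (auto intro: X_filtration.zero)

lemma X_filtration_mult: "X_filtration d a \<Longrightarrow> X_filtration e b \<Longrightarrow> X_filtration (d + e) (a * b)"
  by (induction arbitrary: b rule: X_filtration.induct)
     (auto simp: distrib_right mult.assoc
       intro: X_filtration.zero X_filtration.add X_filtration.X X_filtration_mono[OF X_filtration_symbol_left])

lemma X_filtration_exhaustive: "\<exists>d. X_filtration d p"
proof (induction p rule: weyl_induct)
  case (X i j)
  show ?case using X_filtration.X[OF X_filtration.symbol[OF has_symbol_1], of 0] by auto
next
  case (add p q)
  then obtain d e where "X_filtration d p" "X_filtration e q" by blast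
  then have "X_filtration (max d e) (p + q)"
    by (intro X_filtration.add) (auto elim: X_filtration_mono)
  then show ?case by blast
qed (blast intro: X_filtration.symbol has_symbol.intros X_filtration_mult)+

section \<open>Reduction to constant coefficients\<close>

lemma left_ideal_hull: "left_ideal (left_ideal hull S)"
  unfolding hull_def left_ideal_def by blast

lemma left_ideal_minus: "left_ideal I \<Longrightarrow> a \<in> I \<Longrightarrow> - a \<in> I"
  unfolding left_ideal_def by (metis mult_minus1)

lemma left_ideal_diff: "left_ideal I \<Longrightarrow> a \<in> I \<Longrightarrow> b \<in> I \<Longrightarrow> a - b \<in> I"
  using left_ideal_minus[of I b] unfolding left_ideal_def by (metis diff_conv_add_uminus)

lemma left_ideal_sum: "left_ideal I \<Longrightarrow> (\<And>k. k \<in> A \<Longrightarrow> a k \<in> I) \<Longrightarrow> (\<Sum>k\<in>A. a k) \<in> I"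
  by (induction A rule: infinite_finite_induct) (auto simp: left_ideal_def)

definition ideal_plus_filtration :: "'n::finite weyl set \<Rightarrow> nat \<Rightarrow> 'n weyl set" where
  "ideal_plus_filtration I d = {a + b | a b. a \<in> I \<and> X_filtration d b}"

context
  fixes I :: "'n::finite weyl set"
  assumes I: "left_ideal I"
begin

lemma ideal_plus_filtration_ideal: "a \<in> I \<Longrightarrow> a \<in> ideal_plus_filtration I d"
proof -
  assume "a \<in> I"
  moreover have "a = a + 0" by simp
  ultimately show ?thesis unfolding ideal_plus_filtration_def using X_filtration.zero by blast
qed

lemma ideal_plus_filtration_filtration: "X_filtration d a \<Longrightarrow> a \<in> ideal_plus_filtration I d"
proof -
  assume "X_filtration d a"
  moreover have "0 \<in> I" using I by (simp add: left_ideal_def)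
  moreover have "a = 0 + a" by simp
  ultimately show ?thesis unfolding ideal_plus_filtration_def by blast
qed

lemma ideal_plus_filtration_add:
  assumes "a \<in> ideal_plus_filtration I d" "b \<in> ideal_plus_filtration I d"
  shows "a + b \<in> ideal_plus_filtration I d"
proof -
  obtain p q r s where "a = p + q" "b = r + s" "p \<in> I" "X_filtration d q" "r \<in> I" "X_filtration d s"
    using assms unfolding ideal_plus_filtration_def by blast
  then have "a + b = (p + r) + (q + s)" "p + r \<in> I" "X_filtration d (q + s)"
    using I by (auto simp: left_ideal_def intro: X_filtration.add)
  then show ?thesis unfolding ideal_plus_filtration_def by blast
qed

lemma ideal_plus_filtration_minus:
  assumes "a \<in> ideal_plus_filtration I d"
  shows "- a \<in> ideal_plus_filtration I d"
proof -
  obtain p q where "a = p + q" "p \<in> I" "X_filtration d q"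
    using assms unfolding ideal_plus_filtration_def by blast
  then have "- a = - p + - q" "- p \<in> I" "X_filtration d (- q)"
    by (auto intro: X_filtration_minus left_ideal_minus[OF I])
  then show ?thesis unfolding ideal_plus_filtration_def by blast
qed

lemma ideal_plus_filtration_diff:
  "a \<in> ideal_plus_filtration I d \<Longrightarrow> b \<in> ideal_plus_filtration I d \<Longrightarrow> a - b \<in> ideal_plus_filtration I d"
  using ideal_plus_filtration_add[OF _ ideal_plus_filtration_minus, of a d b] by simp

lemma ideal_plus_filtration_sum:
  "(\<And>k. k \<in> A \<Longrightarrow> a k \<in> ideal_plus_filtration I d) \<Longrightarrow> (\<Sum>k\<in>A. a k) \<in> ideal_plus_filtration I d"
  by (induction A rule: infinite_finite_induct)
     (auto intro: ideal_plus_filtration_add ideal_plus_filtration_filtration X_filtration.zero)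

lemma ideal_plus_filtration_X:
  assumes "a \<in> ideal_plus_filtration I d"
  shows "Xop i j * a \<in> ideal_plus_filtration I (Suc d)"
proof -
  obtain p q where "a = p + q" "p \<in> I" "X_filtration d q"
    using assms unfolding ideal_plus_filtration_def by blast
  then have "Xop i j * a = Xop i j * p + Xop i j * q" "Xop i j * p \<in> I" "X_filtration (Suc d) (Xop i j * q)"
    using I by (auto simp: left_ideal_def distrib_left intro: X_filtration.X)
  then show ?thesis unfolding ideal_plus_filtration_def by blast
qed

text \<open>\<open>I\<close> is only a left ideal, so \<open>r * a\<close> may lie outside it; but
  \<open>a * r\<close> lies in it, and the commutator has lower degree.\<close>

lemma ideal_symbol_mult:
  assumes "has_symbol r g" "r \<in> I" "X_filtration (Suc d) a"
  shows "r * a \<in> ideal_plus_filtration I d"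
proof -
  have "r * a = a * r + (r * a - a * r)" by simp
  moreover have "a * r \<in> I" using assms(2) I by (simp add: left_ideal_def)
  moreover have "X_filtration d (r * a - a * r)"
    using X_filtration_commutator[OF assms(1,3)] by simp
  ultimately show ?thesis unfolding ideal_plus_filtration_def by blast
qed

end

section \<open>The generators and their commutators with the coordinates\<close>

definition column_op :: "'n \<Rightarrow> 'n \<Rightarrow> 'n::finite weyl" where
  "column_op i j = of_bool (i = j) - (\<Sum>k\<in>UNIV. Dop k i * Dop k j)"

definition row_op :: "'n \<Rightarrow> 'n \<Rightarrow> 'n::finite weyl" where
  "row_op i j = of_bool (i = j) - (\<Sum>k\<in>UNIV. Dop i k * Dop j k)"

text \<open>The entries of x^T d/dx. The skew part is the infinitesimal action of right
  multiplication of \<open>x\<close> by rotations.\<close>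

definition gram_op :: "'n \<Rightarrow> 'n \<Rightarrow> 'n::finite weyl" where
  "gram_op i j = (\<Sum>k\<in>UNIV. Xop k i * Dop k j)"

lemma has_symbol_column_op: "has_symbol (column_op i j) (\<lambda>w. of_bool (i = j) - (\<Sum>k\<in>UNIV. w $ k $ i * w $ k $ j))"
  unfolding column_op_def by (intro has_symbol_intros)

lemma has_symbol_row_op: "has_symbol (row_op i j) (\<lambda>w. of_bool (i = j) - (\<Sum>k\<in>UNIV. w $ i $ k * w $ j $ k))"
  unfolding row_op_def by (intro has_symbol_intros)

lemma column_op_X:
  "column_op i j * Xop k l = Xop k l * column_op i j
     - (of_bool (i = l) * Dop k j + of_bool (j = l) * Dop k i)"
proof -
  have "Dop m i * Dop m j * Xop k l = Xop k l * (Dop m i * Dop m j)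
      + (of_bool (m = k) * (of_bool (i = l) * Dop m j) + of_bool (m = k) * (of_bool (j = l) * Dop m i))" for m
  proof -
    have "Dop m i * (Dop m j * Xop k l) = Dop m i * (Xop k l * Dop m j + of_bool (m = k \<and> j = l))"
      by (simp only: weyl_relations(3))
    also have "\<dots> = (Dop m i * Xop k l) * Dop m j + of_bool (m = k \<and> j = l) * Dop m i"
      by (simp add: algebra_simps)
    also have "\<dots> = Xop k l * Dop m i * Dop m j + of_bool (m = k \<and> i = l) * Dop m j + of_bool (m = k \<and> j = l) * Dop m i"
      by (simp only: weyl_relations(3) distrib_right)
    finally show ?thesis by (simp add: algebra_simps of_bool_conj)
  qed
  then have "(\<Sum>m\<in>UNIV. Dop m i * Dop m j) * Xop k l = Xop k l * (\<Sum>m\<in>UNIV. Dop m i * Dop m j)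
      + (\<Sum>m\<in>UNIV. of_bool (m = k) * (of_bool (i = l) * Dop m j) + of_bool (m = k) * (of_bool (j = l) * Dop m i))"
    by (simp only: sum_distrib_right sum_distrib_left sum.distrib)
  also have "(\<Sum>m\<in>UNIV. of_bool (m = k) * (of_bool (i = l) * Dop m j) + of_bool (m = k) * (of_bool (j = l) * Dop m i))
      = of_bool (i = l) * Dop k j + of_bool (j = l) * Dop k i"
    by (simp add: sum.distrib of_bool_def if_distrib[of "\<lambda>x. x * _"] cong: if_cong)
  finally show ?thesis
    by (simp add: column_op_def algebra_simps)
qed

lemma gram_op_X: "gram_op i j * Xop k l = Xop k l * gram_op i j + of_bool (j = l) * Xop k i"
proof -
  have "Xop m i * Dop m j * Xop k l = Xop k l * (Xop m i * Dop m j) + of_bool (m = k) * (of_bool (j = l) * Xop m i)" for m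
  proof -
    have "Xop m i * (Dop m j * Xop k l) = Xop m i * Xop k l * Dop m j + of_bool (m = k \<and> j = l) * Xop m i"
      by (simp only: weyl_relations(3)) (simp add: algebra_simps)
    then show ?thesis by (simp add: weyl_relations(1)[of m] algebra_simps of_bool_conj)
  qed
  then show ?thesis
    by (simp add: gram_op_def sum_distrib_right sum_distrib_left sum.distrib)
qed

text \<open>The relations that lower the degree, for all index pairs. The determinant relation has
  constant coefficients and enters through the assumption \<open>base\<close> of
  \<open>subset_if_symbols_subset\<close>.\<close>

locale fisher_ideal =
  fixes I :: "'n::finite weyl set"
  assumes I: "left_ideal I"
    and column_op: "column_op i j \<in> I" and row_op: "row_op i j \<in> I"
    and gram_op: "gram_op i j - gram_op j i \<in> I"
begin

text \<open>
  Modulo \<open>I\<close>, the commutator with \<open>column_op i j\<close> acts as a derivation along the direction normal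
  to the group that is dual to the symmetric part of \<open>gram_op\<close>, so this is minus twice the Euler operator.
\<close>

definition euler_op :: "'n weyl" where
  "euler_op = (\<Sum>i\<in>UNIV. \<Sum>j\<in>UNIV. gram_op i j * column_op i j)"

lemma euler_op_X:
  "euler_op * Xop k l = Xop k l * euler_op + (\<Sum>i\<in>UNIV. Xop k i * column_op i l)
     - ((\<Sum>j\<in>UNIV. gram_op l j * Dop k j) + (\<Sum>i\<in>UNIV. gram_op i l * Dop k i))"
proof -
  have "gram_op i j * column_op i j * Xop k l = Xop k l * (gram_op i j * column_op i j)
      + of_bool (j = l) * (Xop k i * column_op i j)
      - (of_bool (i = l) * (gram_op i j * Dop k j) + of_bool (j = l) * (gram_op i j * Dop k i))" for i j
  proof -
    have "gram_op i j * column_op i j * Xop k l = gram_op i j * (column_op i j * Xop k l)"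
      by (simp add: mult.assoc)
    also have "\<dots> = (gram_op i j * Xop k l) * column_op i j
      - (of_bool (i = l) * (gram_op i j * Dop k j) + of_bool (j = l) * (gram_op i j * Dop k i))"
      unfolding column_op_X by (simp add: algebra_simps)
    finally show ?thesis unfolding gram_op_X by (simp add: algebra_simps)
  qed
  then have "euler_op * Xop k l = Xop k l * euler_op
      + (\<Sum>i\<in>UNIV. \<Sum>j\<in>UNIV. of_bool (j = l) * (Xop k i * column_op i j))
      - ((\<Sum>i\<in>UNIV. \<Sum>j\<in>UNIV. of_bool (i = l) * (gram_op i j * Dop k j))
        + (\<Sum>i\<in>UNIV. \<Sum>j\<in>UNIV. of_bool (j = l) * (gram_op i j * Dop k i)))"
    by (simp add: euler_op_def sum_distrib_right sum_distrib_left sum.distrib sum_subtractf)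
  moreover have "(\<Sum>i\<in>UNIV. \<Sum>j\<in>UNIV. of_bool (i = l) * F i j) = (\<Sum>j\<in>UNIV. F l j)"
    and "(\<Sum>i\<in>UNIV. \<Sum>j\<in>UNIV. of_bool (j = l) * F i j) = (\<Sum>i\<in>UNIV. F i l)" for F :: "'n \<Rightarrow> 'n \<Rightarrow> 'n weyl"
    by (subst sum.swap) (simp_all add: of_bool_def if_distrib[of "\<lambda>x. x * _"] cong: if_cong)
  ultimately show ?thesis by simp
qed

text \<open>The left side is an entry of x^T D D^T, with D the matrix of the derivatives, and the
  row relations measure how far D D^T is from the identity.\<close>

lemma gram_op_D: "(\<Sum>j\<in>UNIV. gram_op l j * Dop k j) = Xop k l - (\<Sum>c\<in>UNIV. Xop c l * row_op c k)"
proof -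
  have "(\<Sum>j\<in>UNIV. gram_op l j * Dop k j) = (\<Sum>c\<in>UNIV. Xop c l * (\<Sum>j\<in>UNIV. Dop c j * Dop k j))"
    unfolding gram_op_def sum_distrib_left sum_distrib_right by (subst sum.swap) (simp add: mult.assoc)
  also have "\<dots> = (\<Sum>c\<in>UNIV. Xop c l * of_bool (c = k)) - (\<Sum>c\<in>UNIV. Xop c l * row_op c k)"
    by (simp add: row_op_def right_diff_distrib sum_subtractf)
  also have "(\<Sum>c\<in>UNIV. Xop c l * of_bool (c = k)) = Xop k l"
    by (simp add: of_bool_def if_distrib[of "\<lambda>x. _ * x"] cong: if_cong)
  finally show ?thesis .
qed

text \<open>The level gained by the coordinate is lost again in the commutator of \<open>r\<close>
  and \<open>a\<close>.\<close>

lemma X_mult_lower: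
  assumes "has_symbol r g" "r \<in> I" "X_filtration d a"
  shows "Xop i j * r * a \<in> ideal_plus_filtration I d"
proof (cases d)
  case 0
  then show ?thesis
    using assms X_filtration_0[of a] by (simp add: ideal_plus_filtration_filtration[OF I] X_filtration.zero)
next
  case (Suc e)
  show ?thesis
    using ideal_plus_filtration_X[OF I ideal_symbol_mult[OF I assms(1,2)], of e a i j] assms(3)
    unfolding Suc by (simp add: mult.assoc)
qed

text \<open>Moving the rotation to the right of \<open>a\<close> puts it into \<open>I\<close>, and
  the commutator with a vector field linear in the coordinates keeps the degree.\<close>

lemma gram_op_skew:
  assumes "X_filtration d a"
  shows "(gram_op i j - gram_op j i) * a \<in> ideal_plus_filtration I d"
proof -
  have 1: "gram_op i j * a - a * gram_op i j
      = (\<Sum>k\<in>UNIV. Xop k i * Dop k j * a - a * (Xop k i * Dop k j))" for i j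
    by (simp add: gram_op_def sum_distrib_left sum_distrib_right sum_subtractf)
  have 2: "X_filtration d (gram_op i j * a - a * gram_op i j)" for i j
    unfolding 1 by (intro X_filtration_sum X_filtration_vector_field_commutator assms)
  have "(gram_op i j - gram_op j i) * a = a * (gram_op i j - gram_op j i)
      + ((gram_op i j * a - a * gram_op i j) - (gram_op j i * a - a * gram_op j i))"
    by (simp add: algebra_simps)
  moreover have "a * (gram_op i j - gram_op j i) \<in> I"
    using gram_op I by (simp add: left_ideal_def)
  ultimately show ?thesis
    unfolding ideal_plus_filtration_def using X_filtration_diff[OF 2[of i j] 2[of j i]] by blast
qed

text \<open>Passing one coordinate through \<open>euler_op\<close> subtracts two sums, each
  congruent to that coordinate: the first by the row relations, the second because it differs from
  the first by rotations. Level \<open>Suc d\<close> allows at most \<open>d\<close> coordinates,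
  hence the constant \<open>2 * d\<close>.\<close>

lemma euler_op:
  "X_filtration (Suc d) a \<Longrightarrow> euler_op * a + of_nat (2 * d) * a \<in> ideal_plus_filtration I d"
proof (induction "Suc d" a arbitrary: d rule: X_filtration.induct)
  case (zero d)
  then show ?case by (simp add: ideal_plus_filtration_filtration[OF I] X_filtration.zero)
next
  case (symbol r g d)
  have "gram_op i j * column_op i j * r \<in> I" for i j
    using has_symbol_commute[OF has_symbol_column_op symbol, of i j] I column_op[of i j]
    by (simp add: left_ideal_def mult.assoc)
  then have "euler_op * r \<in> I"
    unfolding euler_op_def sum_distrib_right by (intro left_ideal_sum I)
  then have "euler_op * r \<in> ideal_plus_filtration I d" by (rule ideal_plus_filtration_ideal[OF I])
  moreover have "of_nat (2 * d) * r \<in> ideal_plus_filtration I d"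
  proof (cases d)
    case 0
    then show ?thesis by (simp add: ideal_plus_filtration_filtration[OF I] X_filtration.zero)
  next
    case (Suc e)
    then show ?thesis
      using X_filtration.symbol[OF has_symbol.mult[OF has_symbol_of_int symbol], of e "int (2 * d)"]
      by (intro ideal_plus_filtration_filtration[OF I]) (simp only: of_int_of_nat_eq)
  qed
  ultimately show ?case by (rule ideal_plus_filtration_add[OF I])
next
  case (X d a k l)
  show ?case
  proof (cases d)
    case 0
    then show ?thesis
      using X X_filtration_0[of a] by (simp add: ideal_plus_filtration_filtration[OF I] X_filtration.zero)
  next
    case (Suc e)
    have F: "X_filtration d a" by fact
    have 1: "Xop k l * (euler_op * a + of_nat (2 * e) * a) \<in> ideal_plus_filtration I d"
      using X(2)[OF Suc] unfolding Suc by (rule ideal_plus_filtration_X[OF I])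
    have 2: "(\<Sum>i\<in>UNIV. Xop k i * column_op i l * a) \<in> ideal_plus_filtration I d"
      by (intro ideal_plus_filtration_sum[OF I] X_mult_lower[OF has_symbol_column_op column_op F])
    have 3: "(\<Sum>c\<in>UNIV. Xop c l * row_op c k * a) \<in> ideal_plus_filtration I d"
      by (intro ideal_plus_filtration_sum[OF I] X_mult_lower[OF has_symbol_row_op row_op F])
    have 4: "(\<Sum>i\<in>UNIV. (gram_op i l - gram_op l i) * (Dop k i * a)) \<in> ideal_plus_filtration I d"
      by (intro ideal_plus_filtration_sum[OF I] gram_op_skew X_filtration_D F)
    \<comment> \<open>The second sum of \<open>euler_op_X\<close> carries the indices of
      \<open>gram_op\<close> in the wrong order for \<open>gram_op_D\<close>; exchanging them costs
      the rotations bounded in fact 4.\<close>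
    have "(\<Sum>i\<in>UNIV. gram_op i l * Dop k i) * a
        = (\<Sum>j\<in>UNIV. gram_op l j * Dop k j) * a + (\<Sum>i\<in>UNIV. (gram_op i l - gram_op l i) * (Dop k i * a))"
      by (simp add: sum_distrib_right left_diff_distrib sum_subtractf mult.assoc)
    then have "euler_op * (Xop k l * a) + of_nat (2 * d) * (Xop k l * a)
        = Xop k l * (euler_op * a + of_nat (2 * e) * a) + (\<Sum>i\<in>UNIV. Xop k i * column_op i l * a)
          + (\<Sum>c\<in>UNIV. Xop c l * row_op c k * a) + (\<Sum>c\<in>UNIV. Xop c l * row_op c k * a)
          - (\<Sum>i\<in>UNIV. (gram_op i l - gram_op l i) * (Dop k i * a))"
      unfolding mult.assoc[symmetric, of euler_op] euler_op_X distrib_right left_diff_distrib gram_op_D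
      by (simp add: Suc sum_distrib_right algebra_simps mult_of_nat_commute mult_2 mult_2_right)
    then show ?thesis
      by (simp only: ideal_plus_filtration_add[OF I] ideal_plus_filtration_diff[OF I] 1 2 3 4)
  qed
next
  case (add a b)
  have "euler_op * (a + b) + of_nat (2 * d) * (a + b)
      = (euler_op * a + of_nat (2 * d) * a) + (euler_op * b + of_nat (2 * d) * b)"
    by (simp add: algebra_simps)
  with add show ?case by (metis ideal_plus_filtration_add[OF I])
qed

text \<open>
  If \<open>p\<close> lies in \<open>K\<close>, so do the commutators of \<open>p\<close> with \<open>column_op i j\<close>, which have lower degree;
  the Euler operator recovers the leading term of \<open>p\<close> from them.
\<close>

theorem subset_if_symbols_subset:
  assumes K: "left_ideal K" "I \<subseteq> K" and base: "\<And>r g. has_symbol r g \<Longrightarrow> r \<in> K \<Longrightarrow> r \<in> I"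
  shows "K \<subseteq> I"
proof -
  have "p \<in> I" if "X_filtration d p" "p \<in> K" for d p
    using that
  proof (induction d arbitrary: p)
    case 0
    then show ?case using X_filtration_0 I by (auto simp: left_ideal_def)
  next
    case (Suc d)
    show ?case
    proof (cases d)
      \<comment> \<open>Level one consists of the constant coefficient operators, to which
        \<open>base\<close> applies.\<close>
      case 0
      have "X_filtration e a \<Longrightarrow> e = Suc 0 \<Longrightarrow> \<exists>g. has_symbol a g" for e a
      proof (induction rule: X_filtration.induct)
        case (X d a i j)
        then show ?case using X_filtration_0[of a] has_symbol_0 by auto
      qed (auto intro: has_symbol_intros)
      then show ?thesis using Suc.prems 0 base by blast
    next
      case (Suc e)
      have comm: "column_op i j * p \<in> I" for i j
      proof -
        have "p * column_op i j \<in> I" using I column_op by (simp add: left_ideal_def)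
        moreover have "X_filtration d (column_op i j * p - p * column_op i j)"
          using X_filtration_commutator[OF has_symbol_column_op Suc.prems(1)] by simp
        moreover have "column_op i j * p - p * column_op i j \<in> K"
          using Suc.prems(2) K \<open>p * column_op i j \<in> I\<close>
          by (intro left_ideal_diff) (auto simp: left_ideal_def)
        ultimately have "(column_op i j * p - p * column_op i j) + p * column_op i j \<in> I"
          using Suc.IH I unfolding left_ideal_def by blast
        then show ?thesis by simp
      qed
      have e: "euler_op * p \<in> I"
        unfolding euler_op_def sum_distrib_right
        by (intro left_ideal_sum I) (use I comm in \<open>simp add: left_ideal_def mult.assoc\<close>)
      obtain a b where ab: "euler_op * p + of_nat (2 * d) * p = a + b" "a \<in> I" "X_filtration d b"
        using euler_op[OF Suc.prems(1)] unfolding ideal_plus_filtration_def by blast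
      have "of_nat (2 * d) * p \<in> K" using K Suc.prems(2) by (simp add: left_ideal_def)
      then have "euler_op * p + of_nat (2 * d) * p - a \<in> K"
        using K e ab(2) by (intro left_ideal_diff) (auto simp: left_ideal_def)
      then have "b \<in> I" using Suc.IH ab by simp
      then have "a + b - euler_op * p \<in> I"
        using I ab(2) e by (intro left_ideal_diff) (auto simp: left_ideal_def)
      then have "of_nat (2 * d) * p \<in> I" by (simp flip: ab(1))
      \<comment> \<open>Here \<open>d\<close> is positive, so \<open>2 * d\<close> is
        invertible.\<close>
      then have "weyl_const (1 / of_nat (2 * d)) * (of_nat (2 * d) * p) \<in> I"
        using I unfolding left_ideal_def by blast
      moreover have "weyl_const (1 / of_nat (2 * d)) * (of_nat (2 * d) * p) = p"
        using Suc by (simp add: weyl_const_simps del: of_nat_mult of_nat_Suc flip: mult.assoc weyl_const_of_nat)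
      ultimately show ?thesis by simp
    qed
  qed
  then show ?thesis using X_filtration_exhaustive by blast
qed

end

section \<open>Polynomial functions\<close>

inductive polyfun :: "(complex^'n^'n \<Rightarrow> complex) \<Rightarrow> bool" where
  const: "polyfun (\<lambda>_. c)"
| coord: "polyfun (\<lambda>w. w $ i $ j)"
| add: "polyfun g \<Longrightarrow> polyfun h \<Longrightarrow> polyfun (\<lambda>w. g w + h w)"
| mult: "polyfun g \<Longrightarrow> polyfun h \<Longrightarrow> polyfun (\<lambda>w. g w * h w)"

lemma has_symbol_polyfun: "has_symbol r g \<Longrightarrow> polyfun g"
  by (induction rule: has_symbol.induct) (auto intro: polyfun.intros)

lemma polyfun_symbol: "polyfun g \<Longrightarrow> \<exists>r. has_symbol r g"
  by (induction rule: polyfun.induct) (blast intro: has_symbol.intros)+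

lemma polyfun_minus: "polyfun g \<Longrightarrow> polyfun (\<lambda>w. - g w)"
  using polyfun.mult[OF polyfun.const[of "-1"], of g] by simp

lemma polyfun_diff: "polyfun g \<Longrightarrow> polyfun h \<Longrightarrow> polyfun (\<lambda>w. g w - h w)"
  using polyfun.add[OF _ polyfun_minus, of g h] by simp

lemma polyfun_sum: "(\<And>k. k \<in> A \<Longrightarrow> polyfun (g k)) \<Longrightarrow> polyfun (\<lambda>w. \<Sum>k\<in>A. g k w)"
  by (induction A rule: infinite_finite_induct) (auto intro: polyfun.intros)

lemma polyfun_prod: "(\<And>k. k \<in> A \<Longrightarrow> polyfun (g k)) \<Longrightarrow> polyfun (\<lambda>w. \<Prod>k\<in>A. g k w)"
  by (induction A rule: infinite_finite_induct) (auto intro: polyfun.intros)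

lemma polyfun_power: "polyfun g \<Longrightarrow> polyfun (\<lambda>w. g w ^ k)"
  by (induction k) (auto intro: polyfun.intros)

lemmas polyfun_intros = polyfun.intros polyfun_minus polyfun_diff polyfun_sum polyfun_prod polyfun_power

lemma polyfun_compose:
  "polyfun g \<Longrightarrow> (\<And>i j. polyfun (\<lambda>w. T w $ i $ j)) \<Longrightarrow> polyfun (\<lambda>w. g (T w))"
  by (induction rule: polyfun.induct) (auto intro: polyfun.intros)

lemma polyfun_line:
  assumes "polyfun g"
  shows "\<exists>q. \<forall>t. g (\<chi> i j. x $ i $ j + t * y $ i $ j) = poly q t"
  using assms
proof (induction rule: polyfun.induct)
  case (const c)
  show ?case by (rule exI[of _ "[:c:]"]) simp
next
  case (coord i j)
  show ?case by (rule exI[of _ "[:x $ i $ j, y $ i $ j:]"]) simp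
next
  case (add g h)
  then show ?case by (metis poly_add)
next
  case (mult g h)
  then show ?case by (metis poly_mult)
qed

text \<open>Restricting to the line through \<open>u\<close> and \<open>v\<close> reduces the
  absence of zero divisors to polynomials in one variable.\<close>

lemma polyfun_mult_eq_0:
  assumes "polyfun g" "polyfun h" "\<And>w. g w * h w = 0" "g u \<noteq> 0"
  shows "h v = 0"
proof -
  let ?l = "\<lambda>t. \<chi> i j. u $ i $ j + t * (\<chi> i j. v $ i $ j - u $ i $ j) $ i $ j"
  obtain p where p: "\<And>t. g (?l t) = poly p t" using polyfun_line[OF assms(1)] by blast
  obtain q where q: "\<And>t. h (?l t) = poly q t" using polyfun_line[OF assms(2)] by blast
  have ends: "?l 0 = u" "?l 1 = v" by (simp_all add: vec_eq_iff)
  have "poly (p * q) t = 0" for t using assms(3)[of "?l t"] p q by simp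
  then have "p * q = 0" by (metis poly_all_0_iff_0)
  moreover have "p \<noteq> 0" using p[of 0] assms(4) by (auto simp: ends)
  ultimately show ?thesis using q[of 1] by (simp add: ends)
qed

text \<open>The entries are freed from being real one at a time: in a single entry the function is a
  polynomial with infinitely many real roots. \<open>S\<close> collects the entries already
  freed.\<close>

lemma polyfun_eq_0_real:
  fixes g :: "complex^'n^'n \<Rightarrow> complex"
  assumes "polyfun g" and real: "\<And>w. (\<And>i j. w $ i $ j \<in> \<real>) \<Longrightarrow> g w = 0"
  shows "g w = 0"
proof -
  have "(\<And>i j. (i, j) \<notin> S \<Longrightarrow> w $ i $ j \<in> \<real>) \<Longrightarrow> g w = 0" if "finite S" for S w
    using that
  proof (induction S arbitrary: w rule: finite_induct)
    case empty
    then show ?case using real by simp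
  next
    case (insert ij S)
    obtain a b where ij: "ij = (a, b)" by force
    let ?e = "(\<chi> i j. of_bool (i = a \<and> j = b)) :: complex^'n^'n"
    let ?l = "\<lambda>t. \<chi> i j. (\<chi> i j. if i = a \<and> j = b then 0 else w $ i $ j) $ i $ j + t * ?e $ i $ j"
    obtain q where q: "\<And>t. g (?l t) = poly q t" using polyfun_line[OF assms(1)] by blast
    have "poly q (of_real t) = 0" for t
      unfolding q[symmetric]
    proof (rule insert.IH)
      fix i j assume "(i, j) \<notin> S"
      then show "?l (of_real t) $ i $ j \<in> \<real>" using insert.prems[of i j] by (auto simp: ij)
    qed
    then have "range complex_of_real \<subseteq> {t. poly q t = 0}" by auto
    moreover have "infinite (range complex_of_real)"
      using infinite_UNIV_char_0[where 'a = real] by (simp add: finite_image_iff inj_on_def)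
    ultimately have "q = 0" using poly_roots_finite finite_subset by blast
    moreover have "?l (w $ a $ b) = w" by (auto simp: vec_eq_iff)
    ultimately show ?case using q[of "w $ a $ b"] by simp
  qed
  from this[of UNIV w] show ?thesis by simp
qed

subsection \<open>Operators are determined by their symbols\<close>

text \<open>Records which derivatives may occur, for an induction on the set of variables.\<close>

inductive has_symbol_on :: "('n \<times> 'n) set \<Rightarrow> 'n::finite weyl \<Rightarrow> (complex^'n^'n \<Rightarrow> complex) \<Rightarrow> bool"
  for S where
  const: "has_symbol_on S (weyl_const c) (\<lambda>_. c)"
| D: "(i, j) \<in> S \<Longrightarrow> has_symbol_on S (Dop i j) (\<lambda>w. w $ i $ j)"
| add: "has_symbol_on S r g \<Longrightarrow> has_symbol_on S s h \<Longrightarrow> has_symbol_on S (r + s) (\<lambda>w. g w + h w)"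
| mult: "has_symbol_on S r g \<Longrightarrow> has_symbol_on S s h \<Longrightarrow> has_symbol_on S (r * s) (\<lambda>w. g w * h w)"

lemma has_symbol_on_0: "has_symbol_on S 0 (\<lambda>_. 0)" and has_symbol_on_1: "has_symbol_on S 1 (\<lambda>_. 1)"
  using has_symbol_on.const[of S 0] has_symbol_on.const[of S 1] by (simp_all add: weyl_const_simps)

lemma has_symbol_onD: "has_symbol_on S r g \<Longrightarrow> has_symbol r g"
  by (induction rule: has_symbol_on.induct) (auto intro: has_symbol.intros)

lemma has_symbol_on_UNIV: "has_symbol r g \<Longrightarrow> has_symbol_on UNIV r g"
  by (induction rule: has_symbol.induct) (auto intro: has_symbol_on.intros)

lemma has_symbol_on_indep:
  "has_symbol_on S r g \<Longrightarrow> (i, j) \<notin> S \<Longrightarrow> g (\<chi> k l. if k = i \<and> l = j then c else w $ k $ l) = g w"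
  by (induction rule: has_symbol_on.induct) auto

text \<open>Horner form in the single variable \<open>Dop i j\<close> with coefficients over
  \<open>S\<close>: it exposes the constant term, which the injectivity proof splits off.\<close>

inductive horner_symbol ::
    "('n \<times> 'n) set \<Rightarrow> 'n \<Rightarrow> 'n \<Rightarrow> 'n::finite weyl \<Rightarrow> (complex^'n^'n \<Rightarrow> complex) \<Rightarrow> bool"
  for S i j where
  base: "has_symbol_on S r g \<Longrightarrow> horner_symbol S i j r g"
| step: "has_symbol_on S s h \<Longrightarrow> horner_symbol S i j r g \<Longrightarrow>
    horner_symbol S i j (s + r * Dop i j) (\<lambda>w. h w + g w * w $ i $ j)"

lemma horner_symbolD: "horner_symbol S i j r g \<Longrightarrow> has_symbol r g"
proof (induction rule: horner_symbol.induct)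
  case (step s h r g)
  then show ?case by (auto intro!: has_symbol.add has_symbol.mult has_symbol.D dest: has_symbol_onD)
qed (rule has_symbol_onD)

lemma horner_symbol_add:
  "horner_symbol S i j r g \<Longrightarrow> horner_symbol S i j s h \<Longrightarrow> horner_symbol S i j (r + s) (\<lambda>w. g w + h w)"
proof (induction arbitrary: s h rule: horner_symbol.induct)
  case (base r g)
  from base(2) show ?case
  proof cases
    case base
    then show ?thesis by (intro horner_symbol.base has_symbol_on.add \<open>has_symbol_on S r g\<close>)
  next
    case (step s' h' r' g')
    from horner_symbol.step[OF has_symbol_on.add[OF base(1) step(3)] step(4)]
    show ?thesis by (simp add: step(1,2) add.assoc)
  qed
next
  case (step s' h' r g)
  from step.prems show ?case
  proof cases
    case base
    from horner_symbol.step[OF has_symbol_on.add[OF step(1) base] step(2)]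
    show ?thesis by (simp add: add_ac)
  next
    case (step t k r' g')
    from horner_symbol.step[OF has_symbol_on.add[OF \<open>has_symbol_on S s' h'\<close> step(3)] \<open>\<And>s h. horner_symbol S i j s h \<Longrightarrow> _\<close>[OF step(4)]]
    show ?thesis by (simp add: step(1,2) algebra_simps)
  qed
qed

lemma horner_symbol_mult_D:
  "horner_symbol S i j r g \<Longrightarrow> horner_symbol S i j (r * Dop i j) (\<lambda>w. g w * w $ i $ j)"
  using horner_symbol.step[OF has_symbol_on_0, of S i j r g] by simp

lemma horner_symbol_mult_base:
  assumes "has_symbol_on S s h"
  shows "horner_symbol S i j r g \<Longrightarrow> horner_symbol S i j (s * r) (\<lambda>w. h w * g w)"
proof (induction rule: horner_symbol.induct)
  case (base r g)
  then show ?case by (intro horner_symbol.base has_symbol_on.mult assms)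
next
  case (step t k r g)
  from horner_symbol.step[OF has_symbol_on.mult[OF assms step(1)] step(3)]
  show ?case by (simp add: algebra_simps)
qed

lemma horner_symbol_mult:
  assumes "horner_symbol S i j s h"
  shows "horner_symbol S i j r g \<Longrightarrow> horner_symbol S i j (r * s) (\<lambda>w. g w * h w)"
proof (induction rule: horner_symbol.induct)
  case (base r g)
  then show ?case by (intro horner_symbol_mult_base assms)
next
  case (step t k r g)
  from horner_symbol_add[OF horner_symbol_mult_base[OF step(1) assms] horner_symbol_mult_D[OF step(3)]]
  show ?case
    by (simp add: algebra_simps has_symbol_D_commute[OF horner_symbolD[OF assms]])
qed

lemma has_symbol_on_insert: "has_symbol_on (insert (i, j) S) r g \<Longrightarrow> horner_symbol S i j r g"
proof (induction rule: has_symbol_on.induct)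
  case (D k l)
  show ?case
  proof (cases "(k, l) = (i, j)")
    case True
    then show ?thesis
      using horner_symbol_mult_D[OF horner_symbol.base[OF has_symbol_on_1], of S i j] by simp
  next
    case False
    then show ?thesis using D by (auto intro: horner_symbol.base has_symbol_on.D)
  qed
qed (auto intro: horner_symbol.base has_symbol_on.const horner_symbol_add horner_symbol_mult)

lemma has_symbol_on_eq_0:
  "finite S \<Longrightarrow> has_symbol_on S r g \<Longrightarrow> (\<And>w. g w = 0) \<Longrightarrow> r = 0"
proof (induction S arbitrary: r g rule: finite_induct)
  case empty
  have "\<exists>c. r = weyl_const c \<and> g = (\<lambda>_. c)"
    using empty.prems(1)
    by (induction rule: has_symbol_on.induct) (auto simp: weyl_const_simps)
  with empty.prems(2) show ?case by (auto simp: weyl_const_simps)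
next
  case (insert ij S)
  obtain i j where ij: "ij = (i, j)" by force
  have "horner_symbol S i j r g \<Longrightarrow> (\<forall>w. g w = 0) \<longrightarrow> r = 0" for r g
  proof (induction rule: horner_symbol.induct)
    case (base r g)
    then show ?case using insert.IH by blast
  next
    case (step s h r g)
    show ?case
    proof
      assume 0: "\<forall>w. h w + g w * w $ i $ j = 0"
      \<comment> \<open>Setting the entry \<open>(i, j)\<close> to zero removes the second summand
        and leaves \<open>h\<close> unchanged.\<close>
      have h: "h w = 0" for w
        using 0[rule_format, of "\<chi> k l. if k = i \<and> l = j then 0 else w $ k $ l"]
          has_symbol_on_indep[OF step(1), of i j 0 w] insert.hyps(2) by (simp add: ij)
      \<comment> \<open>The coordinate can be cancelled because it is a nonzero polynomial, for
        instance at the all-ones matrix.\<close>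
      have "g w = 0" for w
      proof (rule polyfun_mult_eq_0[of "\<lambda>w. w $ i $ j" g "\<chi> k l. 1"])
        show "polyfun g" using has_symbol_polyfun[OF horner_symbolD[OF step(2)]] .
        show "w $ i $ j * g w = 0" for w using 0[rule_format, of w] h[of w] by (simp add: mult.commute)
      qed (auto intro: polyfun.coord)
      then have "r = 0" using step(3) by blast
      moreover have "s = 0" using insert.IH[OF step(1)] h by blast
      ultimately show "s + r * Dop i j = 0" by simp
    qed
  qed
  then show ?case using has_symbol_on_insert[of i j S r g] insert.prems unfolding ij by blast
qed

text \<open>Carries the result on polynomials back to operators: an operator whose symbol is also
  the symbol of an element of the ideal is that element.\<close>

lemma has_symbol_inject:
  assumes "has_symbol r g" "has_symbol s g"
  shows "r = s"
  using has_symbol_on_eq_0[OF finite has_symbol_on_UNIV[OF has_symbol_diff[OF assms]]] by simp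

section \<open>The action on the Fisher integral\<close>

text \<open>
  Since \<open>trace (x ** y)\<close> pairs \<open>x $ i $ j\<close> with \<open>y $ j $ i\<close>, symbols are evaluated at the transposes of
  group elements.
\<close>

definition ctranspose :: "real^'n^'n \<Rightarrow> complex^'n^'n" where
  "ctranspose y = (\<chi> i j. of_real (y $ j $ i))"

text \<open>Fisher integrals with a polynomial weight form a family closed under differentiation, so
  the action of an operator can be computed by induction on its symbol.\<close>

definition weighted_fisher :: "(real^'n^'n) measure \<Rightarrow> (complex^'n^'n \<Rightarrow> complex) \<Rightarrow> complex^'n^'n \<Rightarrow> complex" where
  "weighted_fisher \<mu> g x = (\<integral>y. g (ctranspose y) * exp (trace (x ** map_matrix complex_of_real y)) \<partial>\<mu>)"

lemma polyfun_continuous_ctranspose: "polyfun g \<Longrightarrow> continuous_on S (\<lambda>y. g (ctranspose y))"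
  by (induction rule: polyfun.induct) (auto simp: ctranspose_def intro!: continuous_intros)

lemma polyfun_bounded_ctranspose:
  "polyfun g \<Longrightarrow> \<exists>B. \<forall>y\<in>special_orthogonal. norm (g (ctranspose y)) \<le> B"
proof (induction rule: polyfun.induct)
  case (coord i j)
  show ?case by (rule exI[of _ 1]) (simp add: ctranspose_def special_orthogonal_entry_le)
next
  case (add g h)
  then obtain B C where "\<forall>y\<in>special_orthogonal. norm (g (ctranspose y)) \<le> B"
    "\<forall>y\<in>special_orthogonal. norm (h (ctranspose y)) \<le> C" by blast
  then show ?case by (intro exI[of _ "B + C"]) (blast intro: norm_triangle_mono)
next
  case (mult g h)
  then obtain B C where "\<forall>y\<in>special_orthogonal. norm (g (ctranspose y)) \<le> B"
    "\<forall>y\<in>special_orthogonal. norm (h (ctranspose y)) \<le> C" by blast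
  then show ?case
    by (intro exI[of _ "B * C"]) (auto simp: norm_mult intro!: mult_mono intro: order_trans[OF norm_ge_zero])
qed auto

section \<open>Group operations and rotations in coordinate planes\<close>

lemma special_orthogonal_mult:
  "y \<in> special_orthogonal \<Longrightarrow> z \<in> special_orthogonal \<Longrightarrow> y ** z \<in> special_orthogonal"
  for y z :: "real^'n^'n"
  by (simp add: special_orthogonal_def det_mul matrix_transpose_mul)
     (metis matrix_mul_assoc matrix_mul_lid)

lemma special_orthogonal_transpose:
  "y \<in> special_orthogonal \<Longrightarrow> transpose y \<in> special_orthogonal" for y :: "real^'n^'n"
  by (simp add: special_orthogonal_def matrix_left_right_inverse)

definition plane_rotation :: "'n::finite \<Rightarrow> 'n \<Rightarrow> real \<Rightarrow> real^'n^'n" where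
  "plane_rotation i j t = (\<chi> k a. if a = i then of_bool (k = i) * cos t - of_bool (k = j) * sin t
     else if a = j then of_bool (k = i) * sin t + of_bool (k = j) * cos t else of_bool (k = a))"

lemma plane_rotation_mult_right:
  fixes x :: "'a::real_normed_field^'n^'n"
  assumes "i \<noteq> j"
  shows "(x ** map_matrix of_real (plane_rotation i j t)) $ k $ a =
    (if a = i then x $ k $ i * of_real (cos t) - x $ k $ j * of_real (sin t)
     else if a = j then x $ k $ i * of_real (sin t) + x $ k $ j * of_real (cos t) else x $ k $ a)"
  using assms
  by (simp add: matrix_matrix_mult_def plane_rotation_def of_bool_def ring_distribs sum.distrib sum_subtractf
      if_distrib[of "\<lambda>x. _ * x"] if_distrib[of "of_real"] if_distrib[of "\<lambda>x. x * _"] cong: if_cong)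

lemma plane_rotation_in:
  fixes i j :: "'n::finite"
  assumes "i \<noteq> j"
  shows "plane_rotation i j t \<in> special_orthogonal"
proof -
  have id: "map_matrix id y = y" for y :: "real^'n^'n" by (simp add: vec_eq_iff)
  have entry: "(x ** plane_rotation i j t) $ k $ a =
    (if a = i then x $ k $ i * cos t - x $ k $ j * sin t
     else if a = j then x $ k $ i * sin t + x $ k $ j * cos t else x $ k $ a)" for x :: "real^'n^'n" and k a t
    using plane_rotation_mult_right[OF assms, of x t k a] by (simp add: id)
  have mult: "plane_rotation i j s ** plane_rotation i j t = plane_rotation i j (s + t)" for s t
  proof -
    have "(plane_rotation i j s ** plane_rotation i j t) $ k $ a = plane_rotation i j (s + t) $ k $ a" for k a
      unfolding entry using assms
      by (auto simp: plane_rotation_def of_bool_def sin_add cos_add)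
    then show ?thesis by (simp add: vec_eq_iff)
  qed
  have transpose: "transpose (plane_rotation i j s) = plane_rotation i j (- s)" for s
    using assms by (auto simp: vec_eq_iff transpose_def plane_rotation_def of_bool_def)
  have 0: "plane_rotation i j 0 = mat 1"
    by (auto simp: vec_eq_iff mat_def plane_rotation_def of_bool_def)
  have orth: "transpose (plane_rotation i j s) ** plane_rotation i j s = mat 1" for s
    by (simp add: transpose mult 0)
  \<comment> \<open>Halving the angle makes the determinant a square, which rules out -1.\<close>
  have "det (plane_rotation i j t) = det (plane_rotation i j (t / 2)) * det (plane_rotation i j (t / 2))"
    using mult[of "t / 2" "t / 2"] by (metis det_mul field_sum_of_halves)
  also have "\<dots> = det (transpose (plane_rotation i j (t / 2)) ** plane_rotation i j (t / 2))"
    by (simp add: det_mul)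
  finally show ?thesis by (simp add: special_orthogonal_def orth)
qed

context
  fixes \<mu> :: "(real^'n^'n) measure"
  assumes haar: "haar_probability \<mu>"
begin

lemma haar_space: "space \<mu> = special_orthogonal"
  using haar sets_eq_imp_space_eq[of \<mu> "restrict_space borel special_orthogonal"]
  by (simp add: haar_probability_def space_restrict_space)

lemma weighted_fisher_1: "weighted_fisher \<mu> (\<lambda>_. 1) = fisher_integral \<mu>"
  by (simp add: weighted_fisher_def fisher_integral_def fun_eq_iff)

lemma weighted_fisher_integrable:
  assumes "polyfun g"
  shows "integrable \<mu> (\<lambda>y. g (ctranspose y) * exp (trace (x ** map_matrix complex_of_real y)))"
proof -
  obtain B where B: "\<And>y. y \<in> special_orthogonal \<Longrightarrow> norm (g (ctranspose y)) \<le> B"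
    using polyfun_bounded_ctranspose[OF assms] by blast
  let ?C = "(real CARD('n))\<^sup>2 * norm x"
  show ?thesis
  proof (rule haar_integrable[OF haar])
    show "norm (g (ctranspose y) * exp (trace (x ** map_matrix complex_of_real y))) \<le> B * exp ?C"
      if "y \<in> special_orthogonal" for y
    proof -
      have "norm (exp (trace (x ** map_matrix complex_of_real y))) \<le> exp ?C"
        using norm_exp[of "trace (x ** map_matrix complex_of_real y)"] norm_trace_le[OF that, of x]
        by (meson exp_le_cancel_iff order_trans)
      then show ?thesis
        unfolding norm_mult using B[OF that] by (intro mult_mono) (auto intro: order_trans[OF norm_ge_zero])
    qed
  qed (intro continuous_intros polyfun_continuous_ctranspose assms continuous_on_trace)
qed

text \<open>Differentiation under the integral: the second order remainder of the exponential is
  bounded quadratically in the increment, uniformly over the group, and the weight only contributes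
  its bound \<open>B\<close>.\<close>

lemma weighted_fisher_has_derivative:
  assumes g: "polyfun g"
  shows "(weighted_fisher \<mu> g has_derivative
    (\<lambda>h. \<Sum>i\<in>UNIV. \<Sum>k\<in>UNIV. weighted_fisher \<mu> (\<lambda>w. w $ i $ k * g w) x * h $ i $ k)) (at x)"
proof -
  interpret prob_space \<mu> using haar by (simp add: haar_probability_def)
  obtain B where B: "\<And>y. y \<in> special_orthogonal \<Longrightarrow> norm (g (ctranspose y)) \<le> B"
    using polyfun_bounded_ctranspose[OF g] by blast
  have "B \<ge> 0"
  proof -
    have "(mat 1 :: real^'n^'n) \<in> special_orthogonal" by (simp add: special_orthogonal_def transpose_mat)
    from B[OF this] show ?thesis using norm_ge_zero order_trans by blast
  qed
  define C where "C = (real CARD('n))\<^sup>2"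
  define L where "L = (\<lambda>(x :: complex^'n^'n) y. trace (x ** map_matrix complex_of_real y))"
  have C: "C \<ge> 0" by (simp add: C_def)
  have L_add: "L (x + h) y = L x y + L h y" for x h y
    by (simp add: L_def trace_map_matrix distrib_left sum.distrib)
  have L_le: "norm (L x y) \<le> C * norm x" if "y \<in> special_orthogonal" for x y
    using norm_trace_le[OF that] by (simp add: L_def C_def)
  have exp_le: "norm (exp (L x y)) \<le> exp (C * norm x)" if "y \<in> special_orthogonal" for x y
    using norm_exp[of "L x y"] L_le[OF that, of x] by (meson exp_le_cancel_iff order_trans)
  let ?G = "\<lambda>y. g (ctranspose y)"
  have F: "weighted_fisher \<mu> g x = (\<integral>y. ?G y * exp (L x y) \<partial>\<mu>)" for x
    by (simp add: weighted_fisher_def L_def)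
  have int_exp: "integrable \<mu> (\<lambda>y. ?G y * exp (L x y))" for x
    unfolding L_def by (rule weighted_fisher_integrable[OF g])
  have int_entry: "integrable \<mu> (\<lambda>y. of_real (y $ k $ i) * ?G y * exp (L x y))" for x i k
    using weighted_fisher_integrable[OF polyfun.mult[OF polyfun.coord[of i k] g], of x]
    by (simp add: L_def ctranspose_def)
  define a where "a = (\<lambda>x i k. \<integral>y. of_real (y $ k $ i) * ?G y * exp (L x y) \<partial>\<mu>)"
  have a: "weighted_fisher \<mu> (\<lambda>w. w $ i $ k * g w) x = a x i k" for x i k
    by (simp add: weighted_fisher_def a_def L_def ctranspose_def)
  have lin: "(\<Sum>i\<in>UNIV. \<Sum>k\<in>UNIV. a x i k * h $ i $ k) = (\<integral>y. ?G y * exp (L x y) * L h y \<partial>\<mu>)"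
    and int_lin: "integrable \<mu> (\<lambda>y. ?G y * exp (L x y) * L h y)" for x h
  proof -
    have eq: "?G y * exp (L x y) * L h y =
        (\<Sum>i\<in>UNIV. \<Sum>k\<in>UNIV. (of_real (y $ k $ i) * ?G y * exp (L x y)) * h $ i $ k)" for y
      by (simp add: L_def trace_map_matrix sum_distrib_left sum_distrib_right mult_ac)
    show "integrable \<mu> (\<lambda>y. ?G y * exp (L x y) * L h y)"
      unfolding eq by (intro Bochner_Integration.integrable_sum integrable_mult_left int_entry)
    show "(\<Sum>i\<in>UNIV. \<Sum>k\<in>UNIV. a x i k * h $ i $ k) = (\<integral>y. ?G y * exp (L x y) * L h y \<partial>\<mu>)"
      unfolding eq a_def
      by (simp only: Bochner_Integration.integral_sum Bochner_Integration.integrable_sum integrable_mult_left int_entry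
          integral_mult_left_zero)
  qed
  define K where "K = B * (exp (C * norm x) * (exp C * C\<^sup>2))"
  show ?thesis
    unfolding a
  proof (rule has_derivativeI_sandwich[of 1])
    show "bounded_linear (\<lambda>h :: complex^'n^'n. \<Sum>i\<in>UNIV. \<Sum>k\<in>UNIV. a x i k * h $ i $ k)"
      by (intro bounded_linear_sum bounded_linear_const_mult
          bounded_linear_compose[OF bounded_linear_vec_nth] bounded_linear_vec_nth)
    show "((\<lambda>z. K * norm (z - x)) \<longlongrightarrow> 0) (at x)"
      by (auto intro!: tendsto_eq_intros)
    fix z assume z: "z \<noteq> x" "dist z x < 1"
    define h where "h = z - x"
    have zh: "z = x + h" and h: "norm h \<le> 1" "norm h > 0"
      using z by (auto simp: h_def dist_norm)
    have bound: "norm (?G y * exp (L z y) - ?G y * exp (L x y) - ?G y * exp (L x y) * L h y) \<le> K * (norm h)\<^sup>2"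
      if y: "y \<in> special_orthogonal" for y
    proof -
      have "norm (L h y) \<le> C"
        using L_le[OF y, of h] h C mult_left_mono[of "norm h" 1 C] by linarith
      have "norm (exp (L h y) - 1 - L h y) \<le> exp (norm (L h y)) * (norm (L h y))\<^sup>2"
        by (rule norm_exp_remainder)
      also have "\<dots> \<le> exp C * (C * norm h)\<^sup>2"
        using \<open>norm (L h y) \<le> C\<close> L_le[OF y, of h] by (intro mult_mono power_mono) auto
      finally have "norm (?G y) * (norm (exp (L x y)) * norm (exp (L h y) - 1 - L h y))
          \<le> B * (exp (C * norm x) * (exp C * (C * norm h)\<^sup>2))"
        using \<open>B \<ge> 0\<close> by (intro mult_mono exp_le B y) auto
      moreover have "?G y * exp (L z y) - ?G y * exp (L x y) - ?G y * exp (L x y) * L h y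
          = ?G y * (exp (L x y) * (exp (L h y) - 1 - L h y))"
        by (simp add: zh L_add exp_add algebra_simps)
      ultimately show ?thesis
        by (simp add: norm_mult K_def power_mult_distrib mult_ac)
    qed
    have "norm (\<integral>y. ?G y * exp (L z y) - ?G y * exp (L x y) - ?G y * exp (L x y) * L h y \<partial>\<mu>) \<le> K * (norm h)\<^sup>2"
    proof -
      have "norm (\<integral>y. ?G y * exp (L z y) - ?G y * exp (L x y) - ?G y * exp (L x y) * L h y \<partial>\<mu>)
          \<le> (\<integral>y. K * (norm h)\<^sup>2 \<partial>\<mu>)"
        by (intro Bochner_Integration.integral_norm_bound_integral Bochner_Integration.integrable_diff
            int_exp int_lin integrable_const) (use bound haar_space in auto)
      then show ?thesis by (simp add: prob_space)
    qed
    moreover have "(\<integral>y. ?G y * exp (L z y) - ?G y * exp (L x y) - ?G y * exp (L x y) * L h y \<partial>\<mu>)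
        = weighted_fisher \<mu> g z - weighted_fisher \<mu> g x - (\<Sum>i\<in>UNIV. \<Sum>k\<in>UNIV. a x i k * h $ i $ k)"
      unfolding lin
      by (simp add: F Bochner_Integration.integral_diff int_exp int_lin
          Bochner_Integration.integrable_diff)
    ultimately have "norm (weighted_fisher \<mu> g z - weighted_fisher \<mu> g x
        - (\<Sum>i\<in>UNIV. \<Sum>k\<in>UNIV. a x i k * h $ i $ k)) \<le> K * norm h * norm h"
      by (simp only: power2_eq_square mult.assoc)
    then show "norm (weighted_fisher \<mu> g z - weighted_fisher \<mu> g x
        - (\<Sum>i\<in>UNIV. \<Sum>k\<in>UNIV. a x i k * (z - x) $ i $ k)) / norm (z - x) \<le> K * norm (z - x)"
      using h(2) unfolding h_def[symmetric] by (simp only: pos_divide_le_eq)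
  qed simp
qed

lemma weyl_apply_weighted_fisher:
  "has_symbol r g \<Longrightarrow> polyfun h \<Longrightarrow>
    weyl_apply r (weighted_fisher \<mu> h) = weighted_fisher \<mu> (\<lambda>w. g w * h w)"
proof (induction arbitrary: h rule: has_symbol.induct)
  case (const c)
  have "entire (weighted_fisher \<mu> h)" by (rule entireI) (rule weighted_fisher_has_derivative[OF const])
  then show ?case by (simp only: weyl_apply_simps) (simp add: weighted_fisher_def fun_eq_iff mult.assoc)
next
  case (D i j)
  have "entire (weighted_fisher \<mu> h)" by (rule entireI) (rule weighted_fisher_has_derivative[OF D])
  then show ?case
    by (simp add: weyl_apply_simps fun_eq_iff partial_deriv_eq'[OF weighted_fisher_has_derivative[OF D]])
next
  case (add r g s k)
  have "polyfun g" "polyfun k" using add by (auto intro: has_symbol_polyfun)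
  then show ?case
    using add weighted_fisher_integrable[OF polyfun.mult[of g h]] weighted_fisher_integrable[OF polyfun.mult[of k h]]
    by (simp add: weyl_apply_ring) (simp add: weighted_fisher_def fun_eq_iff distrib_right)
next
  case (mult r g s k)
  then show ?case
    by (simp add: weyl_apply_ring polyfun.mult has_symbol_polyfun mult.assoc)
qed

lemma weyl_apply_fisher_integral:
  "has_symbol r g \<Longrightarrow> weyl_apply r (fisher_integral \<mu>) = weighted_fisher \<mu> g"
  using weyl_apply_weighted_fisher[OF _ polyfun.const[of 1], of r g] by (simp add: weighted_fisher_1)

lemma symbol_annihilates:
  assumes "has_symbol r g" "\<And>y. y \<in> special_orthogonal \<Longrightarrow> g (ctranspose y) = 0"
  shows "r \<in> annihilator (fisher_integral \<mu>)"
proof -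
  have "weighted_fisher \<mu> g x = 0" for x
    unfolding weighted_fisher_def
    by (rule integral_eq_zero_AE, rule AE_I2) (simp add: assms(2) haar_space)
  then show ?thesis by (simp add: annihilator_def weyl_apply_fisher_integral[OF assms(1)] fun_eq_iff)
qed

section \<open>Vanishing of symbols on the whole group\<close>

lemma measurable_haar_translation:
  assumes "k \<in> special_orthogonal"
  shows "(\<lambda>y. k ** y) \<in> measurable \<mu> \<mu>"
proof -
  have sets: "sets \<mu> = sets (restrict_space borel special_orthogonal)"
    using haar by (simp add: haar_probability_def)
  have "continuous_on UNIV (\<lambda>y. k ** y)"
    unfolding matrix_matrix_mult_def by (intro continuous_intros)
  then have "(\<lambda>y. k ** y) \<in> measurable (restrict_space borel special_orthogonal) (restrict_space borel special_orthogonal)"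
    by (intro measurable_restrict_space3 borel_measurable_continuous_onI)
       (use assms in \<open>auto intro: special_orthogonal_mult\<close>)
  then show ?thesis using measurable_cong_sets[OF sets sets] by blast
qed

text \<open>The integral of the squared modulus only gives vanishing almost everywhere. Invariance
  under a countable dense set of translations yields one point \<open>z\<close> all of whose
  translates by that set are zeros, and continuity extends this to the whole orbit of
  \<open>z\<close>, which is the group.\<close>

lemma symbol_vanishes:
  assumes r: "has_symbol r g" "r \<in> annihilator (fisher_integral \<mu>)" and y: "y \<in> special_orthogonal"
  shows "g (ctranspose y) = 0"
proof -
  interpret prob_space \<mu> using haar by (simp add: haar_probability_def)
  have g: "polyfun g" using r(1) by (rule has_symbol_polyfun)
  \<comment> \<open>On real matrices conjugation only affects the coefficients, so the conjugate is
    again a polynomial.\<close>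
  have "\<exists>h. polyfun h \<and> (\<forall>y. h (ctranspose y) = cnj (g (ctranspose y)))"
    using g
  proof (induction rule: polyfun.induct)
    case (const c)
    then show ?case using polyfun.const by fastforce
  next
    case (coord i j)
    show ?case by (rule exI[of _ "\<lambda>w. w $ i $ j"]) (auto simp: ctranspose_def intro: polyfun.coord)
  next
    case (add g k)
    then obtain a b where "polyfun a" "polyfun b" "\<forall>y. a (ctranspose y) = cnj (g (ctranspose y))"
      "\<forall>y. b (ctranspose y) = cnj (k (ctranspose y))" by blast
    then show ?case by (intro exI[of _ "\<lambda>w. a w + b w"]) (auto intro: polyfun.add)
  next
    case (mult g k)
    then obtain a b where "polyfun a" "polyfun b" "\<forall>y. a (ctranspose y) = cnj (g (ctranspose y))"
      "\<forall>y. b (ctranspose y) = cnj (k (ctranspose y))" by blast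
    then show ?case by (intro exI[of _ "\<lambda>w. a w * b w"]) (auto intro: polyfun.mult)
  qed
  then obtain h where h: "polyfun h" "\<And>y. h (ctranspose y) = cnj (g (ctranspose y))" by blast
  obtain s where s: "has_symbol s h" using polyfun_symbol[OF h(1)] by blast
  have "weyl_apply (s * r) (fisher_integral \<mu>) = (\<lambda>_. 0)"
    using r(2) weyl_apply_ring(1)[of "\<lambda>_. 0"]
    by (simp add: annihilator_def weyl_apply_ring diff_ops_zero[OF weyl_apply])
  \<comment> \<open>At \<open>x = 0\<close> the exponential is 1, which leaves the integral of the
    squared modulus.\<close>
  then have "weighted_fisher \<mu> (\<lambda>w. h w * g w) 0 = 0"
    by (simp add: weyl_apply_fisher_integral[OF has_symbol.mult[OF s r(1)]])
  then have "(\<integral>y. complex_of_real ((norm (g (ctranspose y)))\<^sup>2) \<partial>\<mu>) = 0"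
    unfolding weighted_fisher_def h(2) trace_map_matrix complex_norm_square by (simp add: mult.commute)
  then have 0: "(\<integral>y. (norm (g (ctranspose y)))\<^sup>2 \<partial>\<mu>) = 0"
    by (simp only: integral_complex_of_real of_real_eq_0_iff)
  have int: "integrable \<mu> (\<lambda>y. (norm (g (ctranspose y)))\<^sup>2)"
  proof -
    have "integrable \<mu> (\<lambda>y. complex_of_real ((norm (g (ctranspose y)))\<^sup>2))"
      using weighted_fisher_integrable[OF polyfun.mult[OF h(1) g], of 0]
      unfolding h(2) trace_map_matrix complex_norm_square by (simp add: mult.commute)
    then show ?thesis by (simp only: complex_of_real_integrable_eq)
  qed
  have ae: "AE y in \<mu>. g (ctranspose y) = 0"
    using integral_nonneg_eq_0_iff_AE[OF int] 0 by simp
  obtain T where T: "countable T" "T \<subseteq> special_orthogonal" "(special_orthogonal :: (real^'n^'n) set) \<subseteq> closure T"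
    using separable by blast
  have "AE y in \<mu>. \<forall>k\<in>T. g (ctranspose (k ** y)) = 0"
  proof (rule AE_ball_countable[THEN iffD2, OF T(1)], rule ballI)
    fix k assume "k \<in> T"
    then have k: "k \<in> special_orthogonal" using T(2) by blast
    show "AE y in \<mu>. g (ctranspose (k ** y)) = 0"
    proof (rule AE_distrD[OF measurable_haar_translation[OF k]])
      show "AE y in distr \<mu> \<mu> (\<lambda>y. k ** y). g (ctranspose y) = 0"
        using ae haar k unfolding haar_probability_def by metis
    qed
  qed
  moreover have "AE y in \<mu>. y \<in> special_orthogonal" using AE_space[of \<mu>] by (simp add: haar_space)
  ultimately have "AE y in \<mu>. y \<in> special_orthogonal \<and> (\<forall>k\<in>T. g (ctranspose (k ** y)) = 0)" by eventually_elim simp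
  from eventually_happens'[OF _ this] have "\<exists>y. y \<in> special_orthogonal \<and> (\<forall>k\<in>T. g (ctranspose (k ** y)) = 0)"
    by (simp add: ae_filter_eq_bot_iff emeasure_space_1)
  then obtain z where z: "z \<in> special_orthogonal" "\<And>k. k \<in> T \<Longrightarrow> g (ctranspose (k ** z)) = 0"
    by blast
  have "continuous_on UNIV (\<lambda>k. k ** z)"
    unfolding matrix_matrix_mult_def by (intro continuous_intros)
  then have "continuous_on UNIV (\<lambda>k. g (ctranspose (k ** z)))"
    by (rule continuous_on_compose2[OF polyfun_continuous_ctranspose[OF g, of UNIV]]) auto
  then have "closed {k. g (ctranspose (k ** z)) = 0}"
    by (intro closed_Collect_eq continuous_on_const)
  then have "closure T \<subseteq> {k. g (ctranspose (k ** z)) = 0}"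
    using z(2) by (intro closure_minimal) auto
  moreover have "y ** transpose z \<in> special_orthogonal"
    using y z(1) by (intro special_orthogonal_mult special_orthogonal_transpose)
  ultimately have "g (ctranspose (y ** transpose z ** z)) = 0" using T(3) by blast
  moreover have "y ** transpose z ** z = y"
    using z(1) by (simp add: special_orthogonal_def flip: matrix_mul_assoc)
  ultimately show ?thesis by simp
qed

lemma fisher_integral_mult_right:
  assumes "k \<in> special_orthogonal"
  shows "fisher_integral \<mu> (x ** map_matrix of_real k) = fisher_integral \<mu> x"
proof -
  let ?E = "\<lambda>y. exp (trace (x ** map_matrix complex_of_real y))"
  have "map_matrix complex_of_real (k ** y) = map_matrix of_real k ** map_matrix of_real y"
    for y :: "real^'n^'n"
    by (simp add: vec_eq_iff matrix_matrix_mult_def)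
  then have "fisher_integral \<mu> (x ** map_matrix of_real k) = (\<integral>y. ?E (k ** y) \<partial>\<mu>)"
    by (simp only: fisher_integral_def matrix_mul_assoc)
  also have "\<dots> = (\<integral>y. ?E y \<partial>distr \<mu> \<mu> (\<lambda>y. k ** y))"
  proof (rule integral_distr[symmetric, OF measurable_haar_translation[OF assms]])
    show "?E \<in> borel_measurable \<mu>"
      using weighted_fisher_integrable[OF polyfun.const[of 1], of x] by (auto dest: borel_measurable_integrable)
  qed
  also have "\<dots> = fisher_integral \<mu> x"
    using haar assms by (simp add: haar_probability_def fisher_integral_def)
  finally show ?thesis .
qed

text \<open>Left invariance of the measure makes the integral constant along the curve of products
  of \<open>x\<close> with \<open>plane_rotation i j t\<close>; its derivative at
  \<open>t = 0\<close> is the value of the operator.\<close>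

lemma gram_op_annihilates:
  "gram_op i j - gram_op j i \<in> annihilator (fisher_integral \<mu>)"
proof (cases "i = j")
  case True
  then show ?thesis by (simp add: annihilator_def weyl_apply_ring)
next
  case False
  let ?f = "fisher_integral \<mu>"
  note f = entire_fisher_integral[OF haar]
  have "(\<Sum>k\<in>UNIV. x $ k $ i * partial_deriv k j ?f x) - (\<Sum>k\<in>UNIV. x $ k $ j * partial_deriv k i ?f x) = 0" for x
  proof -
    define c where "c t = x ** map_matrix of_real (plane_rotation i j t)" for t
    \<comment> \<open>The velocity at 0 of the curve \<open>c\<close>.\<close>
    define c' :: "complex^'n^'n" where
      "c' = (\<chi> k a. if a = i then - x $ k $ j else if a = j then x $ k $ i else 0)"
    have c0: "c 0 = x"
      by (auto simp: c_def vec_eq_iff plane_rotation_mult_right[OF False])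
    define e :: "complex^'n^'n" where "e = (\<chi> k a. if a = i \<or> a = j then x $ k $ a else 0)"
    have "c t = x + ((cos t - 1) *\<^sub>R e + sin t *\<^sub>R c')" for t
      using False
      by (auto simp: c_def c'_def e_def vec_eq_iff plane_rotation_mult_right[OF False])
         (simp_all add: scaleR_conv_of_real algebra_simps)
    moreover have "((\<lambda>t. x + ((cos t - 1) *\<^sub>R e + sin t *\<^sub>R c')) has_derivative (\<lambda>t. t *\<^sub>R c')) (at 0)"
      by (auto intro!: derivative_eq_intros)
    ultimately have c': "(c has_derivative (\<lambda>t. t *\<^sub>R c')) (at 0)" by presburger
    have "((\<lambda>t. ?f (c t)) has_derivative
        (\<lambda>t. \<Sum>k\<in>UNIV. \<Sum>a\<in>UNIV. partial_deriv k a ?f x * (t *\<^sub>R c') $ k $ a)) (at 0)"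
      by (rule has_derivative_compose[OF c', of ?f]) (use entire_has_derivative[OF f, of x] in \<open>simp add: c0\<close>)
    moreover have "?f (c t) = ?f x" for t
      unfolding c_def by (rule fisher_integral_mult_right[OF plane_rotation_in[OF False]])
    ultimately have "(\<lambda>t. \<Sum>k\<in>UNIV. \<Sum>a\<in>UNIV. partial_deriv k a ?f x * (t *\<^sub>R c') $ k $ a) = (\<lambda>_. 0)"
      using has_derivative_unique[OF _ has_derivative_const] by simp
    from fun_cong[OF this, of 1]
    have "(\<Sum>k\<in>UNIV. \<Sum>a\<in>UNIV. partial_deriv k a ?f x * c' $ k $ a) = 0" by simp
    moreover have "(\<Sum>a\<in>UNIV. partial_deriv k a ?f x * c' $ k $ a)
        = x $ k $ i * partial_deriv k j ?f x - x $ k $ j * partial_deriv k i ?f x" for k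
    proof -
      have "(\<Sum>a\<in>UNIV. partial_deriv k a ?f x * c' $ k $ a)
        = (\<Sum>a\<in>UNIV. (if a = j then x $ k $ i * partial_deriv k j ?f x else 0)
            - (if a = i then x $ k $ j * partial_deriv k i ?f x else 0))"
        using False by (intro sum.cong) (auto simp: c'_def)
      then show ?thesis by (simp add: sum_subtractf)
    qed
    ultimately show ?thesis by (simp add: sum_subtractf)
  qed
  moreover have "weyl_apply (gram_op a b) ?f = (\<lambda>x. \<Sum>k\<in>UNIV. x $ k $ a * partial_deriv k b ?f x)" for a b
  proof -
    have "weyl_apply (\<Sum>k\<in>A. Xop k a * Dop k b) ?f = (\<lambda>x. \<Sum>k\<in>A. x $ k $ a * partial_deriv k b ?f x)" for A
      by (induction A rule: infinite_finite_induct)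
         (simp_all add: weyl_apply_ring weyl_apply_simps f entire_partial_deriv)
    then show ?thesis by (simp add: gram_op_def)
  qed
  ultimately show ?thesis by (simp add: annihilator_def weyl_apply_ring fun_eq_iff)
qed

end

section \<open>The vanishing ideal of the special orthogonal group\<close>

lemma polyfun_det: "(\<And>i j. polyfun (\<lambda>w. A w $ i $ j)) \<Longrightarrow> polyfun (\<lambda>w. det (A w))"
  unfolding det_def by (intro polyfun_intros)

text \<open>
  The row relations are redundant here: over a commutative ring a left inverse of a square matrix is
  a right inverse.
\<close>

inductive so_ideal :: "(complex^'n^'n \<Rightarrow> complex) \<Rightarrow> bool" where
  column: "polyfun p \<Longrightarrow> so_ideal (\<lambda>w. p w * (of_bool (i = j) - (\<Sum>k\<in>UNIV. w $ k $ i * w $ k $ j)))"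
| det: "polyfun p \<Longrightarrow> so_ideal (\<lambda>w. p w * (1 - det w))"
| add: "so_ideal a \<Longrightarrow> so_ideal b \<Longrightarrow> so_ideal (\<lambda>w. a w + b w)"

lemma so_ideal_0: "so_ideal (\<lambda>_. 0)"
  using so_ideal.det[OF polyfun.const[of 0]] by simp

lemma so_ideal_mult:
  assumes p: "polyfun p"
  shows "so_ideal a \<Longrightarrow> so_ideal (\<lambda>w. p w * a w)"
proof (induction rule: so_ideal.induct)
  case (column q i j)
  from so_ideal.column[OF polyfun.mult[OF p this]] show ?case by (simp add: mult.assoc)
next
  case (det q)
  from so_ideal.det[OF polyfun.mult[OF p this]] show ?case by (simp add: mult.assoc)
next
  case (add a b)
  from so_ideal.add[OF add(3,4)] show ?case by (simp add: distrib_left)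
qed

lemma so_ideal_minus: "so_ideal a \<Longrightarrow> so_ideal (\<lambda>w. - a w)"
  using so_ideal_mult[OF polyfun.const[of "-1"], of a] by simp

lemma so_ideal_diff: "so_ideal a \<Longrightarrow> so_ideal b \<Longrightarrow> so_ideal (\<lambda>w. a w - b w)"
  using so_ideal.add[OF _ so_ideal_minus, of a b] by simp

lemma so_ideal_sum: "(\<And>k. k \<in> A \<Longrightarrow> so_ideal (a k)) \<Longrightarrow> so_ideal (\<lambda>w. \<Sum>k\<in>A. a k w)"
  by (induction A rule: infinite_finite_induct) (auto intro: so_ideal_0 so_ideal.add)

section \<open>Congruence of polynomials modulo the ideal\<close>

definition so_cong :: "(complex^'n^'n \<Rightarrow> complex) \<Rightarrow> (complex^'n^'n \<Rightarrow> complex) \<Rightarrow> bool" where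
  "so_cong g h \<longleftrightarrow> polyfun g \<and> polyfun h \<and> so_ideal (\<lambda>w. g w - h w)"

lemma so_cong_refl: "polyfun g \<Longrightarrow> so_cong g g"
  by (simp add: so_cong_def so_ideal_0)

lemma so_cong_add:
  assumes "so_cong g h" "so_cong g' h'"
  shows "so_cong (\<lambda>w. g w + g' w) (\<lambda>w. h w + h' w)"
proof -
  have "so_ideal (\<lambda>w. (g w - h w) + (g' w - h' w))"
    using assms by (auto simp: so_cong_def intro: so_ideal.add)
  then show ?thesis using assms by (auto simp: so_cong_def algebra_simps intro: polyfun.add)
qed

lemma so_cong_mult:
  assumes "so_cong g h" "so_cong g' h'"
  shows "so_cong (\<lambda>w. g w * g' w) (\<lambda>w. h w * h' w)"
proof -
  have "so_ideal (\<lambda>w. g w * (g' w - h' w) + h' w * (g w - h w))"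
    using assms by (auto simp: so_cong_def intro: so_ideal.add so_ideal_mult)
  then show ?thesis using assms by (auto simp: so_cong_def algebra_simps intro: polyfun.mult)
qed

lemma so_cong_sum: "(\<And>k. k \<in> A \<Longrightarrow> so_cong (g k) (h k)) \<Longrightarrow> so_cong (\<lambda>w. \<Sum>k\<in>A. g k w) (\<lambda>w. \<Sum>k\<in>A. h k w)"
  by (induction A rule: infinite_finite_induct) (auto intro: so_cong_refl polyfun.const so_cong_add)

lemma so_cong_prod: "(\<And>k. k \<in> A \<Longrightarrow> so_cong (g k) (h k)) \<Longrightarrow> so_cong (\<lambda>w. \<Prod>k\<in>A. g k w) (\<lambda>w. \<Prod>k\<in>A. h k w)"
  by (induction A rule: infinite_finite_induct) (auto intro: so_cong_refl polyfun.const so_cong_mult)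

lemma so_cong_power: "so_cong g h \<Longrightarrow> so_cong (\<lambda>w. g w ^ k) (\<lambda>w. h w ^ k)"
  by (induction k) (auto intro: so_cong_refl polyfun.const so_cong_mult)

lemma so_cong_det:
  "(\<And>i j. so_cong (\<lambda>w. A w $ i $ j) (\<lambda>w. B w $ i $ j)) \<Longrightarrow> so_cong (\<lambda>w. det (A w)) (\<lambda>w. det (B w))"
  unfolding det_def by (intro so_cong_sum so_cong_mult so_cong_prod so_cong_refl polyfun.const)

lemma so_ideal_cong: "so_cong g h \<Longrightarrow> so_ideal g \<longleftrightarrow> so_ideal h"
  using so_ideal_diff[of g "\<lambda>w. g w - h w"] so_ideal.add[of h "\<lambda>w. g w - h w"]
  by (auto simp: so_cong_def)

lemma so_ideal_const_mult: "c \<noteq> 0 \<Longrightarrow> so_ideal (\<lambda>w. c * a w) \<Longrightarrow> so_ideal a"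
  using so_ideal_mult[OF polyfun.const[of "1 / c"], of "\<lambda>w. c * a w"] by simp

text \<open>Every term of the expanded power contains \<open>a w ^ M\<close> or
  \<open>b w ^ N\<close>. The induction avoids the expansion by absorbing one factor
  \<open>a\<close> or \<open>b\<close> into \<open>g\<close>.\<close>

lemma so_ideal_power_add:
  assumes "polyfun a" "polyfun b"
  shows "polyfun g \<Longrightarrow> so_ideal (\<lambda>w. a w ^ M * g w) \<Longrightarrow> so_ideal (\<lambda>w. b w ^ N * g w) \<Longrightarrow>
    so_ideal (\<lambda>w. (a w + b w) ^ (M + N) * g w)"
proof (induction "M + N" arbitrary: M N g)
  case 0
  then show ?case by simp
next
  case (Suc k)
  show ?case
  proof (cases "M = 0 \<or> N = 0")
    case True
    then have "so_ideal g" using Suc by auto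
    then show ?thesis by (intro so_ideal_mult polyfun_intros assms)
  next
    case False
    then obtain m n where mn: "M = Suc m" "N = Suc n" by (metis not0_implies_Suc)
    have "so_ideal (\<lambda>w. (a w + b w) ^ (m + N) * (a w * g w))"
    proof (rule Suc(1))
      show "so_ideal (\<lambda>w. a w ^ m * (a w * g w))" using Suc(4) by (simp add: mn mult_ac)
      show "so_ideal (\<lambda>w. b w ^ N * (a w * g w))"
        using so_ideal_mult[OF assms(1) Suc(5)] by (simp add: mult_ac)
    qed (use Suc mn assms in \<open>auto intro: polyfun.mult\<close>)
    moreover have "so_ideal (\<lambda>w. (a w + b w) ^ (M + n) * (b w * g w))"
    proof (rule Suc(1))
      show "so_ideal (\<lambda>w. b w ^ n * (b w * g w))" using Suc(5) by (simp add: mn mult_ac)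
      show "so_ideal (\<lambda>w. a w ^ M * (b w * g w))"
        using so_ideal_mult[OF assms(2) Suc(4)] by (simp add: mult_ac)
    qed (use Suc mn assms in \<open>auto intro: polyfun.mult\<close>)
    ultimately have "so_ideal (\<lambda>w. (a w + b w) ^ (m + N) * (a w * g w) + (a w + b w) ^ (M + n) * (b w * g w))"
      by (rule so_ideal.add)
    then show ?thesis by (simp add: mn algebra_simps)
  qed
qed

text \<open>Glues local membership: if the \<open>a k\<close> add up to a unit modulo the ideal,
  \<open>g\<close> itself lies in it.\<close>

lemma so_ideal_power_sum:
  assumes "polyfun g" "finite A"
    and "\<And>k. k \<in> A \<Longrightarrow> polyfun (a k) \<and> (\<exists>M. so_ideal (\<lambda>w. a k w ^ M * g w))"
  shows "\<exists>M. so_ideal (\<lambda>w. (\<Sum>k\<in>A. a k w) ^ M * g w)"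
  using assms(2,3)
proof (induction A rule: finite_induct)
  case empty
  show ?case by (rule exI[of _ 1]) (simp add: so_ideal_0)
next
  case (insert k A)
  then obtain N where N: "so_ideal (\<lambda>w. (\<Sum>k\<in>A. a k w) ^ N * g w)" by auto
  obtain M where M: "so_ideal (\<lambda>w. a k w ^ M * g w)" using insert.prems by blast
  from so_ideal_power_add[OF _ _ assms(1) M N] insert show ?case
    by (auto intro!: polyfun_sum)
qed

subsection \<open>The Cayley retraction\<close>

lemma matrix_diff_ldistrib: "A ** (B - C) = A ** B - A ** C" for A B C :: "complex^'n^'n"
  by (simp add: vec_eq_iff matrix_matrix_mult_def right_diff_distrib sum_subtractf)

lemma matrix_diff_rdistrib: "(B - C) ** A = B ** A - C ** A" for A B C :: "complex^'n^'n"
  by (simp add: vec_eq_iff matrix_matrix_mult_def left_diff_distrib sum_subtractf)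

lemma matrix_mult_minus: "(- A) ** B = - (A ** B)" "A ** (- B) = - (A ** B)" for A B :: "complex^'n^'n"
  by (simp_all add: vec_eq_iff matrix_matrix_mult_def sum_negf)

lemma matrix_add_rdistrib: "(B + C) ** A = B ** A + C ** A" for A B C :: "complex^'n^'n"
  by (simp add: vec_eq_iff matrix_matrix_mult_def distrib_right sum.distrib)

lemma matrix_transpose_add: "transpose (A + B) = transpose A + transpose B" for A B :: "complex^'n^'n"
  by (simp add: transpose_def vec_eq_iff)

lemma mat_mult_nth: "(mat c ** A) $ i $ j = c * A $ i $ j" "(A ** mat c) $ i $ j = A $ i $ j * c"
  for A :: "complex^'n^'n"
  by (simp_all add: matrix_matrix_mult_def mat_def if_distrib[of "\<lambda>x. x * _"] if_distrib[of "\<lambda>x. _ * x"]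
      cong: if_cong)

lemma mat_commute: "A ** mat c = mat c ** A" for A :: "complex^'n^'n"
  by (simp add: vec_eq_iff mat_mult_nth mult.commute)

lemma mat_mult_mat: "mat c ** mat d = mat (c * d)" for c d :: complex
  unfolding vec_eq_iff mat_mult_nth by (simp add: mat_def)

text \<open>
  The adjugate multiplied by the determinant; thanks to this factor it commutes with the matrix
  also in the singular case, for trivial reasons.
\<close>

definition scaled_adjugate :: "complex^'n^'n \<Rightarrow> complex^'n^'n" where
  "scaled_adjugate A = (\<chi> k j. det A * det (\<chi> i l. if l = k then of_bool (i = j) else A $ i $ l))"

lemma scaled_adjugate_mult:
  "A ** scaled_adjugate A = mat ((det A)\<^sup>2)" "scaled_adjugate A ** A = mat ((det A)\<^sup>2)"
proof -
  have "A ** scaled_adjugate A = mat ((det A)\<^sup>2) \<and> scaled_adjugate A ** A = mat ((det A)\<^sup>2)"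
  proof (cases "det A = 0")
    case True
    then show ?thesis by (simp add: scaled_adjugate_def vec_eq_iff matrix_matrix_mult_def)
  next
    case False
    then obtain B where B: "A ** B = mat 1" "B ** A = mat 1"
      using invertible_det_nz[of A] by (auto simp: invertible_def)
    \<comment> \<open>Cramer's rule for the columns of the inverse.\<close>
    have "scaled_adjugate A $ k $ j = (mat ((det A)\<^sup>2) ** B) $ k $ j" for k j
    proof -
      have "(A *v column j B) $ i = (A ** B) $ i $ j" for i
        by (simp add: matrix_vector_mult_def matrix_matrix_mult_def column_def)
      then have "(A *v column j B) $ i = of_bool (i = j)" for i
        by (simp add: B mat_def)
      then show ?thesis
        using cramer_lemma[where A = A and x = "column j B" and k = k]
        by (simp only:) (simp add: scaled_adjugate_def mat_mult_nth column_def power2_eq_square)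
    qed
    then have "scaled_adjugate A = mat ((det A)\<^sup>2) ** B" by (simp add: vec_eq_iff)
    moreover have "A ** (mat c ** B) = mat c ** (A ** B)" for c by (simp add: matrix_mul_assoc mat_commute)
    ultimately show ?thesis by (simp add: B flip: matrix_mul_assoc)
  qed
  then show "A ** scaled_adjugate A = mat ((det A)\<^sup>2)" "scaled_adjugate A ** A = mat ((det A)\<^sup>2)" by auto
qed

lemma polyfun_scaled_adjugate:
  "(\<And>i j. polyfun (\<lambda>w. A w $ i $ j)) \<Longrightarrow> polyfun (\<lambda>w. scaled_adjugate (A w) $ i $ j)"
proof -
  assume A: "\<And>i j. polyfun (\<lambda>w. A w $ i $ j)"
  have "polyfun (\<lambda>w. (\<chi> k l. if l = i then of_bool (k = j) else A w $ k $ l) $ k $ l)" for k l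
    by (cases "l = i") (simp_all add: A polyfun.const)
  then show ?thesis
    unfolding scaled_adjugate_def by simp (intro polyfun.mult polyfun_det A, simp)
qed

lemma polyfun_matrix_mult:
  "(\<And>i j. polyfun (\<lambda>w. A w $ i $ j)) \<Longrightarrow> (\<And>i j. polyfun (\<lambda>w. B w $ i $ j)) \<Longrightarrow>
    polyfun (\<lambda>w. (A w ** B w) $ i $ j)"
  by (simp add: matrix_matrix_mult_def) (intro polyfun_intros)

lemma det_real: "(\<And>i j. A $ i $ j \<in> \<real>) \<Longrightarrow> det A \<in> \<real>" for A :: "complex^'n^'n"
  unfolding det_def by (intro sum_in_Reals Reals_mult prod_in_Reals) auto

lemma scaled_adjugate_real: "(\<And>i j. A $ i $ j \<in> \<real>) \<Longrightarrow> scaled_adjugate A $ i $ j \<in> \<real>"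
  unfolding scaled_adjugate_def by (auto intro!: Reals_mult det_real)

lemma matrix_mult_real:
  "(\<And>i j. A $ i $ j \<in> \<real>) \<Longrightarrow> (\<And>i j. B $ i $ j \<in> \<real>) \<Longrightarrow> (A ** B) $ i $ j \<in> \<real>" for A B :: "complex^'n^'n"
  unfolding matrix_matrix_mult_def by (auto intro!: sum_in_Reals Reals_mult)

definition cayley_det :: "complex^'n^'n \<Rightarrow> complex" where
  "cayley_det w = det (mat 1 + w)"

text \<open>
  If \<open>w\<close> is orthogonal then \<open>cayley_denom w ** (mat 1 + w) = mat (2 * cayley_det w ^ 4)\<close>. For all \<open>w\<close>
  the symmetric part of \<open>cayley_denom w\<close> is scalar, so it commutes with its transpose and
  \<open>transpose (cayley_denom w) ** matrix_inv (cayley_denom w)\<close>, which is \<open>cayley w\<close>, is orthogonal.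
\<close>

definition cayley_denom :: "complex^'n^'n \<Rightarrow> complex^'n^'n" where
  "cayley_denom w = mat (cayley_det w ^ 4)
     + transpose (scaled_adjugate (mat 1 + w)) ** (transpose w - w) ** scaled_adjugate (mat 1 + w)"

text \<open>With Q the matrix \<open>cayley_denom w\<close> and s = 2
  \<open>cayley_det w ^ 4\<close>, the symmetric part of Q being s/2 gives Q^T = s - Q, so Q^T Q^-1
  = s Q^-1 - 1. This is its numerator over the square of det Q.\<close>

definition cayley_num :: "complex^'n^'n \<Rightarrow> complex^'n^'n" where
  "cayley_num w = mat (2 * cayley_det w ^ 4) ** scaled_adjugate (cayley_denom w)
     - mat ((det (cayley_denom w))\<^sup>2)"

definition cayley :: "complex^'n^'n \<Rightarrow> complex^'n^'n" where
  "cayley w = (\<chi> i j. cayley_num w $ i $ j / (det (cayley_denom w))\<^sup>2)"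

lemma polyfun_shift: "polyfun (\<lambda>w. (mat 1 + w) $ i $ j)"
  by (cases "i = j") (simp_all add: mat_def, (intro polyfun_intros)+)

lemma polyfun_cayley_det: "polyfun cayley_det"
  unfolding cayley_det_def[abs_def] by (intro polyfun_det polyfun_shift)

lemma polyfun_mat: "polyfun a \<Longrightarrow> polyfun (\<lambda>w. mat (a w) $ i $ j)"
  by (cases "i = j") (simp_all add: mat_def polyfun.const)

lemma polyfun_cayley_denom: "polyfun (\<lambda>w. cayley_denom w $ i $ j)"
proof -
  have "polyfun (\<lambda>w. transpose (scaled_adjugate (mat 1 + w)) $ i $ j)" for i j :: 'a
    unfolding transpose_def by simp (intro polyfun_scaled_adjugate polyfun_shift)
  moreover have "polyfun (\<lambda>w. (transpose w - w) $ i $ j)" for i j :: 'a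
    unfolding transpose_def by simp (intro polyfun_intros)
  ultimately show ?thesis
    unfolding cayley_denom_def vector_add_component
    by (intro polyfun.add polyfun_mat polyfun_power polyfun_cayley_det polyfun_matrix_mult
        polyfun_scaled_adjugate polyfun_shift)
qed

lemma polyfun_cayley_num: "polyfun (\<lambda>w. cayley_num w $ i $ j)"
  unfolding cayley_num_def vector_minus_component
  by (intro polyfun_diff polyfun_matrix_mult polyfun_mat polyfun.mult polyfun_power polyfun.const
      polyfun_cayley_det polyfun_scaled_adjugate polyfun_cayley_denom polyfun_det)

text \<open>For orthogonal \<open>w\<close>, w^T - w = (1 + w^T)(1 - w), so up to a scalar
  \<open>cayley_denom w\<close> is 1 + A with A = (1 - w)(1 + w)^-1 the classical Cayley transform.
  For general \<open>w\<close> the error is a left multiple of 1 - w^T w.\<close>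

lemma cayley_denom_mult:
  "cayley_denom w ** (mat 1 + w) = mat (2 * cayley_det w ^ 4)
     - mat ((cayley_det w)\<^sup>2) ** transpose (scaled_adjugate (mat 1 + w)) ** (mat 1 - transpose w ** w)"
proof -
  define B where "B = scaled_adjugate (mat 1 + w)"
  define c where "c = (cayley_det w)\<^sup>2"
  have c2: "cayley_det w ^ 4 = c\<^sup>2" by (simp add: c_def flip: power_mult)
  have B: "(mat 1 + w) ** B = mat c" "B ** (mat 1 + w) = mat c"
    unfolding B_def c_def cayley_det_def by (rule scaled_adjugate_mult)+
  have tB: "transpose B ** (mat 1 + transpose w) = mat c"
  proof -
    have "transpose B ** (mat 1 + transpose w) = transpose ((mat 1 + w) ** B)"
      by (simp add: matrix_transpose_mul matrix_transpose_add)
    then show ?thesis by (simp add: B)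
  qed
  have K: "transpose w - w = (mat 1 + transpose w) ** (mat 1 - w) - (mat 1 - transpose w ** w)"
    by (simp add: matrix_add_rdistrib matrix_diff_ldistrib algebra_simps)
  have "cayley_denom w ** (mat 1 + w) = mat (c\<^sup>2) ** (mat 1 + w) + transpose B ** (transpose w - w) ** (B ** (mat 1 + w))"
    by (simp add: cayley_denom_def c2 B_def matrix_add_rdistrib matrix_mul_assoc)
  also have "transpose B ** (transpose w - w) ** (B ** (mat 1 + w)) = mat c ** (transpose B ** (transpose w - w))"
    by (simp add: B mat_commute[of _ c])
  also have "transpose B ** (transpose w - w)
      = mat c ** (mat 1 - w) - transpose B ** (mat 1 - transpose w ** w)"
    unfolding K matrix_diff_ldistrib[of "transpose B" "(mat 1 + transpose w) ** (mat 1 - w)"]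
    by (simp add: matrix_mul_assoc tB)
  also have "mat (c\<^sup>2) ** (mat 1 + w) + mat c ** (mat c ** (mat 1 - w) - transpose B ** (mat 1 - transpose w ** w))
      = mat (2 * c\<^sup>2) - mat c ** transpose B ** (mat 1 - transpose w ** w)"
    unfolding matrix_diff_ldistrib[of "mat c"]
    by (simp add: vec_eq_iff mat_mult_nth flip: matrix_mul_assoc)
       (auto simp: mat_def power2_eq_square algebra_simps)
  finally show ?thesis by (simp only: c2 B_def[symmetric] c_def[symmetric])
qed

lemma so_ideal_column_mult:
  fixes A :: "complex^'n^'n \<Rightarrow> complex^'n^'n"
  assumes "\<And>i j. polyfun (\<lambda>w. A w $ i $ j)"
  shows "so_ideal (\<lambda>w. (A w ** (mat 1 - transpose w ** w)) $ i $ j)"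
proof -
  have "(mat 1 - transpose w ** w) $ k $ j = of_bool (k = j) - (\<Sum>l\<in>UNIV. w $ l $ k * w $ l $ j)"
    for k j and w :: "complex^'n^'n"
    by (simp add: mat_def transpose_def matrix_matrix_mult_def)
  then show ?thesis
    unfolding matrix_matrix_mult_def[of "A _"] vec_lambda_beta
    by (intro so_ideal_sum) (simp only:, intro so_ideal.column assms)
qed

text \<open>The retraction is the identity modulo the ideal, with denominators cleared: multiply
  \<open>cayley_denom_mult\<close> from the left by the scaled adjugate of
  \<open>cayley_denom w\<close>.\<close>

lemma so_cong_cayley_num: "so_cong (\<lambda>w. (det (cayley_denom w))\<^sup>2 * w $ i $ j) (\<lambda>w. cayley_num w $ i $ j)"
proof -
  have 1: "(det (cayley_denom w))\<^sup>2 * w $ i $ j - cayley_num w $ i $ j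
    = - (mat ((cayley_det w)\<^sup>2) ** scaled_adjugate (cayley_denom w) ** transpose (scaled_adjugate (mat 1 + w))
        ** (mat 1 - transpose w ** w)) $ i $ j" for w :: "complex^'a^'a"
  proof -
    define P where "P = scaled_adjugate (cayley_denom w)"
    define R where "R = transpose (scaled_adjugate (mat 1 + w)) ** (mat 1 - transpose w ** w)"
    have "mat ((det (cayley_denom w))\<^sup>2) ** (mat 1 + w) = P ** (cayley_denom w ** (mat 1 + w))"
      by (simp add: P_def matrix_mul_assoc scaled_adjugate_mult)
    also have "\<dots> = P ** mat (2 * cayley_det w ^ 4) - P ** mat ((cayley_det w)\<^sup>2) ** R"
      unfolding cayley_denom_mult by (simp add: R_def matrix_diff_ldistrib matrix_mul_assoc)
    finally have "mat ((det (cayley_denom w))\<^sup>2) ** w = mat (2 * cayley_det w ^ 4) ** P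
        - mat ((det (cayley_denom w))\<^sup>2) - mat ((cayley_det w)\<^sup>2) ** P ** R"
      by (simp add: matrix_add_ldistrib mat_commute[of P] algebra_simps)
    then have "(mat ((det (cayley_denom w))\<^sup>2) ** w) $ i $ j = (cayley_num w - mat ((cayley_det w)\<^sup>2) ** P ** R) $ i $ j"
      by (simp add: cayley_num_def P_def)
    then show ?thesis by (simp add: mat_mult_nth P_def R_def matrix_mul_assoc)
  qed
  have "polyfun (\<lambda>w. transpose (scaled_adjugate (mat 1 + w)) $ i $ j)" for i j :: 'a
    unfolding transpose_def by simp (intro polyfun_scaled_adjugate polyfun_shift)
  then have "so_ideal (\<lambda>w. (det (cayley_denom w))\<^sup>2 * w $ i $ j - cayley_num w $ i $ j)"
    unfolding 1
    by (intro so_ideal_minus so_ideal_column_mult polyfun_matrix_mult polyfun_mat polyfun_power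
        polyfun_cayley_det polyfun_scaled_adjugate polyfun_cayley_denom)
  then show ?thesis
    unfolding so_cong_def
    by (intro conjI polyfun_cayley_num polyfun.mult polyfun_power polyfun_det polyfun_cayley_denom polyfun.coord)
qed

text \<open>Determinants of \<open>cayley_denom_mult\<close>. Modulo the ideal the denominator thus
  divides a constant times a power of \<open>cayley_det\<close>, which lets the former be traded for
  the latter.\<close>

lemma so_cong_cayley_denom:
  "so_cong (\<lambda>w. det (cayley_denom w) * cayley_det w) (\<lambda>w :: complex^'n^'n. (2 * cayley_det w ^ 4) ^ CARD('n))"
proof -
  have "so_cong (\<lambda>w. (cayley_denom w ** (mat 1 + w)) $ i $ j) (\<lambda>w :: complex^'n^'n. (mat (2 * cayley_det w ^ 4) :: complex^'n^'n) $ i $ j)" for i j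
  proof -
    have "polyfun (\<lambda>w. transpose (scaled_adjugate (mat 1 + w)) $ i $ j)" for i j :: 'n
      unfolding transpose_def by simp (intro polyfun_scaled_adjugate polyfun_shift)
    then have "so_ideal (\<lambda>w :: complex^'n^'n. - (mat ((cayley_det w)\<^sup>2) ** transpose (scaled_adjugate (mat 1 + w))
        ** (mat 1 - transpose w ** w)) $ i $ j)"
      by (intro so_ideal_minus so_ideal_column_mult polyfun_matrix_mult polyfun_mat polyfun_power polyfun_cayley_det)
    then have "so_ideal (\<lambda>w. (cayley_denom w ** (mat 1 + w)) $ i $ j - mat (2 * cayley_det w ^ 4) $ i $ j)"
      unfolding cayley_denom_mult by simp
    then show ?thesis
      unfolding so_cong_def
      by (intro conjI polyfun_matrix_mult polyfun_cayley_denom polyfun_shift polyfun_mat polyfun.mult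
          polyfun.const polyfun_power polyfun_cayley_det)
  qed
  from so_cong_det[OF this]
  have "so_cong (\<lambda>w. det (cayley_denom w ** (mat 1 + w)))
      (\<lambda>w :: complex^'n^'n. det (mat (2 * cayley_det w ^ 4) :: complex^'n^'n))" .
  moreover have "det (mat c :: complex^'n^'n) = c ^ CARD('n)" for c
    by (simp add: det_diagonal mat_def)
  ultimately show ?thesis by (simp add: det_mul cayley_det_def)
qed

lemma cayley_orthogonal:
  assumes "det (cayley_denom w) \<noteq> 0"
  shows "transpose (cayley w) ** cayley w = mat 1" "det (cayley w) = 1"
proof -
  define Q where "Q = cayley_denom w"
  define B where "B = scaled_adjugate (mat 1 + w)"
  obtain R where R: "Q ** R = mat 1" "R ** Q = mat 1"
    using assms invertible_det_nz[of Q] by (auto simp: invertible_def Q_def)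
  have "scaled_adjugate Q = (scaled_adjugate Q ** Q) ** R"
    by (simp add: R flip: matrix_mul_assoc)
  then have adj: "scaled_adjugate Q = mat ((det Q)\<^sup>2) ** R" by (simp add: scaled_adjugate_mult)
  define K where "K = transpose B ** (transpose w - w) ** B"
  have Q: "Q = mat (cayley_det w ^ 4) + K" by (simp only: Q_def cayley_denom_def B_def K_def)
  have "transpose (transpose w - w) = - (transpose w - w)" by (simp add: transpose_def vec_eq_iff)
  then have "transpose K = - K"
    unfolding K_def matrix_transpose_mul transpose_transpose by (simp only: matrix_mult_minus matrix_mul_assoc)
  then have "transpose Q = mat (cayley_det w ^ 4) - K" by (simp add: Q matrix_transpose_add)
  then have QT: "transpose Q = mat (2 * cayley_det w ^ 4) - Q" by (simp add: Q vec_eq_iff mat_def)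
  have "cayley w = mat (2 * cayley_det w ^ 4) ** R - mat 1"
  proof -
    have "cayley_num w = mat ((det Q)\<^sup>2) ** (mat (2 * cayley_det w ^ 4) ** R - mat 1)"
      unfolding cayley_num_def Q_def[symmetric] adj
      by (simp add: matrix_diff_ldistrib matrix_mul_assoc mat_mult_mat mult.commute)
    then show ?thesis using assms by (simp add: cayley_def vec_eq_iff mat_mult_nth Q_def)
  qed
  then have eq: "cayley w = transpose Q ** R"
    by (simp add: QT matrix_diff_rdistrib R)
  have comm: "Q ** transpose Q = transpose Q ** Q"
    by (simp add: QT matrix_diff_ldistrib matrix_diff_rdistrib mat_commute[of Q])
  have "transpose (cayley w) ** cayley w = transpose R ** (Q ** transpose Q) ** R"
    by (simp add: eq matrix_transpose_mul matrix_mul_assoc)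
  also have "\<dots> = transpose (Q ** R) ** (Q ** R)"
    unfolding comm by (simp add: matrix_transpose_mul matrix_mul_assoc)
  finally show "transpose (cayley w) ** cayley w = mat 1" by (simp add: R)
  show "det (cayley w) = 1"
    using arg_cong[OF R(1), of det] by (simp add: eq det_mul)
qed

lemma cayley_real:
  assumes real: "\<And>i j. w $ i $ j \<in> \<real>" and nz: "det (cayley_denom w) \<noteq> 0"
  shows "\<exists>y\<in>special_orthogonal. cayley w = ctranspose y"
proof -
  have shift: "(mat 1 + w) $ i $ j \<in> \<real>" for i j using real by (auto simp: mat_def intro: Reals_add)
  have det: "cayley_det w \<in> \<real>" unfolding cayley_det_def by (intro det_real shift)
  have mat: "mat c $ i $ j \<in> \<real>" if "c \<in> \<real>" for c :: complex and i j :: 'a using that by (auto simp: mat_def)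
  have "transpose (scaled_adjugate (mat 1 + w)) $ i $ j \<in> \<real>" for i j
    unfolding transpose_def by simp (intro scaled_adjugate_real shift)
  moreover have "(transpose w - w) $ i $ j \<in> \<real>" for i j by (simp add: transpose_def real)
  ultimately have denom: "cayley_denom w $ i $ j \<in> \<real>" for i j
    unfolding cayley_denom_def vector_add_component
    by (intro Reals_add mat matrix_mult_real Reals_power det scaled_adjugate_real shift)
  have "cayley_num w $ i $ j \<in> \<real>" for i j
    unfolding cayley_num_def vector_minus_component
    by (intro Reals_diff matrix_mult_real mat Reals_mult Reals_power det scaled_adjugate_real denom det_real) simp
  then have "cayley w $ i $ j \<in> \<real>" for i j
    unfolding cayley_def by (auto intro!: Reals_divide Reals_power det_real denom)
  then have eq: "complex_of_real (Re (cayley w $ i $ j)) = cayley w $ i $ j" for i j by simp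
  define y where "y = (\<chi> i j. Re (cayley w $ j $ i))"
  have cy: "cayley w = ctranspose y" by (simp add: ctranspose_def y_def vec_eq_iff eq)
  have "cayley w ** transpose (cayley w) = mat 1"
    using cayley_orthogonal(1)[OF nz] by (simp add: matrix_left_right_inverse)
  then have "(cayley w ** transpose (cayley w)) $ i $ j = mat 1 $ i $ j" for i j by simp
  then have "complex_of_real ((transpose y ** y) $ i $ j) = of_real (mat 1 $ i $ j)" for i j
    by (simp add: cy ctranspose_def matrix_matrix_mult_def transpose_def mat_def)
  then have "transpose y ** y = mat 1" by (simp only: of_real_eq_iff vec_eq_iff) simp
  moreover have "complex_of_real (det (transpose y)) = det (cayley w)"
    by (simp add: cy ctranspose_def det_def transpose_def)
  then have "det y = 1" by (simp add: cayley_orthogonal(2)[OF nz])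
  ultimately show ?thesis using cy by (auto simp: special_orthogonal_def)
qed

text \<open>\<open>p\<close> is the pullback of \<open>g\<close> with denominators cleared. At zeros
  of the denominator \<open>cayley w\<close> has only a default value, hence the restriction in the
  second claim.\<close>

lemma cayley_pullback:
  assumes "polyfun g"
  shows "\<exists>M p. so_cong (\<lambda>w. det (cayley_denom w) ^ M * g w) p \<and>
    (\<forall>w. det (cayley_denom w) \<noteq> 0 \<longrightarrow> p w = det (cayley_denom w) ^ M * g (cayley w))"
  using assms
proof (induction rule: polyfun.induct)
  case (const c)
  show ?case
    by (rule exI[of _ 0], rule exI[of _ "\<lambda>_. c"]) (simp add: so_cong_refl polyfun.const)
next
  case (coord i j)
  show ?case
    by (rule exI[of _ 2], rule exI[of _ "\<lambda>w. cayley_num w $ i $ j"])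
       (simp add: so_cong_cayley_num cayley_def)
next
  case (add g h)
  then obtain M p N q where
    p: "so_cong (\<lambda>w. det (cayley_denom w) ^ M * g w) p"
      "\<And>w. det (cayley_denom w) \<noteq> 0 \<Longrightarrow> p w = det (cayley_denom w) ^ M * g (cayley w)" and
    q: "so_cong (\<lambda>w. det (cayley_denom w) ^ N * h w) q"
      "\<And>w. det (cayley_denom w) \<noteq> 0 \<Longrightarrow> q w = det (cayley_denom w) ^ N * h (cayley w)" by blast
  have pow: "so_cong (\<lambda>w. det (cayley_denom w) ^ k) (\<lambda>w. det (cayley_denom w) ^ k)" for k
    by (intro so_cong_refl polyfun_power polyfun_det polyfun_cayley_denom)
  from so_cong_add[OF so_cong_mult[OF pow[of N] p(1)] so_cong_mult[OF pow[of M] q(1)]]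
  show ?case
    by (intro exI[of _ "M + N"] exI[of _ "\<lambda>w. det (cayley_denom w) ^ N * p w + det (cayley_denom w) ^ M * q w"])
       (simp add: p(2) q(2) power_add algebra_simps)
next
  case (mult g h)
  then obtain M p N q where
    p: "so_cong (\<lambda>w. det (cayley_denom w) ^ M * g w) p"
      "\<And>w. det (cayley_denom w) \<noteq> 0 \<Longrightarrow> p w = det (cayley_denom w) ^ M * g (cayley w)" and
    q: "so_cong (\<lambda>w. det (cayley_denom w) ^ N * h w) q"
      "\<And>w. det (cayley_denom w) \<noteq> 0 \<Longrightarrow> q w = det (cayley_denom w) ^ N * h (cayley w)" by blast
  from so_cong_mult[OF p(1) q(1)]
  show ?case
    by (intro exI[of _ "M + N"] exI[of _ "\<lambda>w. p w * q w"])
       (simp add: p(2) q(2) power_add mult_ac)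
qed

lemma cayley_det_power_mult:
  fixes g :: "complex^'n^'n \<Rightarrow> complex"
  assumes g: "polyfun g" "\<And>y. y \<in> special_orthogonal \<Longrightarrow> g (ctranspose y) = 0"
  shows "\<exists>M. so_ideal (\<lambda>w. cayley_det w ^ M * g w)"
proof -
  let ?D = "\<lambda>w :: complex^'n^'n. det (cayley_denom w)"
  have D: "polyfun ?D" by (intro polyfun_det polyfun_cayley_denom)
  obtain M p where p: "so_cong (\<lambda>w. ?D w ^ M * g w) p"
    "\<And>w. ?D w \<noteq> 0 \<Longrightarrow> p w = ?D w ^ M * g (cayley w)"
    using cayley_pullback[OF g(1)] by blast
  \<comment> \<open>The extra factor \<open>?D w\<close> covers the matrices where
    \<open>cayley\<close> is undefined; at the other real ones \<open>cayley w\<close> lies in the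
    group.\<close>
  have "?D w * p w = 0" for w
  proof (rule polyfun_eq_0_real[of "\<lambda>w. ?D w * p w"])
    show "polyfun (\<lambda>w. ?D w * p w)" using p(1) D by (auto simp: so_cong_def intro: polyfun.mult)
    show "?D w * p w = 0" if "\<And>i j. w $ i $ j \<in> \<real>" for w
      using p(2)[of w] cayley_real[OF that] g(2) by (cases "?D w = 0") auto
  qed
  then have "so_ideal (\<lambda>w. ?D w * (?D w ^ M * g w))"
    using so_ideal_cong[OF so_cong_mult[OF so_cong_refl[OF D] p(1)]] by (simp only: so_ideal_0)
  \<comment> \<open>One factor \<open>cayley_det w\<close> for each of the \<open>Suc M\<close>
    factors \<open>?D w\<close>, as \<open>so_cong_cayley_denom\<close> requires.\<close>
  then have "so_ideal (\<lambda>w. cayley_det w ^ Suc M * (?D w * (?D w ^ M * g w)))"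
    by (rule so_ideal_mult[OF polyfun_power[OF polyfun_cayley_det]])
  then have "so_ideal (\<lambda>w. (?D w * cayley_det w) ^ Suc M * g w)"
    by (simp add: power_mult_distrib mult_ac)
  then have "so_ideal (\<lambda>w. ((2 * cayley_det w ^ 4) ^ CARD('n)) ^ Suc M * g w)"
    using so_ideal_cong[OF so_cong_mult[OF so_cong_power[OF so_cong_cayley_denom] so_cong_refl[OF g(1)]], of "Suc M"]
    by blast
  then have "so_ideal (\<lambda>w. 2 ^ (CARD('n) * Suc M) * (cayley_det w ^ (4 * (CARD('n) * Suc M)) * g w))"
    by (simp only: power_mult_distrib power_mult[symmetric] mult.assoc)
  then have "so_ideal (\<lambda>w. cayley_det w ^ (4 * (CARD('n) * Suc M)) * g w)"
    by (rule so_ideal_const_mult[rotated]) simp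
  then show ?thesis by blast
qed

subsection \<open>Gluing the Cayley charts\<close>

text \<open>
  The translates of the Cayley chart by diagonal sign matrices of determinant one cover the group: averaging
  \<open>det (\<epsilon> + w)\<close> over the signs \<open>\<epsilon>\<close> leaves \<open>det w\<close>, and averaging it against \<open>prod \<epsilon>\<close> leaves \<open>1\<close>.
\<close>

definition sign_vectors :: "('n::finite \<Rightarrow> complex) set" where
  "sign_vectors = UNIV \<rightarrow>\<^sub>E {1, -1}"

definition scale_rows :: "('n \<Rightarrow> complex) \<Rightarrow> complex^'n^'n \<Rightarrow> complex^'n^'n" where
  "scale_rows e w = (\<chi> i j. e i * w $ i $ j)"

lemma sign_vectors_cases: "e \<in> sign_vectors \<Longrightarrow> e i = 1 \<or> e i = -1"
  by (auto simp: sign_vectors_def PiE_iff)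

lemma sign_vectors_square: "e \<in> sign_vectors \<Longrightarrow> e i * e i = 1"
  using sign_vectors_cases[of e i] by auto

lemma det_scale_rows: "det (scale_rows e w) = (\<Prod>i\<in>UNIV. e i) * det w"
  using det_rows_mul[of e "\<lambda>i. w $ i"] by (simp add: scale_rows_def vector_scalar_mult_def)

lemma sum_sign_vectors:
  "(\<Sum>e\<in>sign_vectors. \<Prod>i\<in>UNIV. f i (e i)) = (\<Prod>i\<in>UNIV. f i 1 + f i (-1))"
  for f :: "'n::finite \<Rightarrow> complex \<Rightarrow> complex"
proof -
  have "(\<Prod>i\<in>UNIV. \<Sum>s\<in>{1, -1}. f i s) = (\<Sum>e\<in>sign_vectors. \<Prod>i\<in>UNIV. f i (e i))"
    unfolding sign_vectors_def by (rule prod_sum_PiE) auto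
  then show ?thesis by simp
qed

text \<open>The weight is 2 for signs with product one and 0 for the others, so only translates by
  group elements contribute.\<close>

lemma sum_det_sign_vectors:
  fixes w :: "complex^'n^'n"
  shows "(\<Sum>e\<in>sign_vectors. (1 + (\<Prod>i\<in>UNIV. e i)) * det (scale_rows e (mat 1) + w)) = 2 ^ CARD('n) * (1 + det w)"
proof -
  have sq: "(\<Prod>i\<in>UNIV. e i) * det (scale_rows e (mat 1) + w) = det (mat 1 + scale_rows e w)"
    if "e \<in> sign_vectors" for e
  proof -
    have "mat 1 + scale_rows e w = scale_rows e (scale_rows e (mat 1) + w)"
      using sign_vectors_square[OF that] by (simp add: scale_rows_def vec_eq_iff distrib_left flip: mult.assoc)
    then show ?thesis by (simp add: det_scale_rows)
  qed
  \<comment> \<open>In each Leibniz product the sum over signs factors by rows; the signed diagonal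
    term cancels and the entry of \<open>w\<close> is doubled. In the companion sum the roles are
    exchanged.\<close>
  have "(\<Sum>e\<in>sign_vectors. det (scale_rows e (mat 1) + w)) = 2 ^ CARD('n) * det w"
  proof -
    have "(\<Sum>e\<in>sign_vectors. det (scale_rows e (mat 1) + w))
        = (\<Sum>p | p permutes UNIV. of_int (sign p) * (\<Sum>e\<in>sign_vectors. \<Prod>i\<in>UNIV. e i * mat 1 $ i $ p i + w $ i $ p i))"
      unfolding det_def by (subst sum.swap) (simp add: scale_rows_def sum_distrib_left)
    also have "\<dots> = (\<Sum>p | p permutes UNIV. of_int (sign p) * (2 ^ CARD('n) * (\<Prod>i\<in>UNIV. w $ i $ p i)))"
      by (subst sum_sign_vectors) (simp add: prod.distrib flip: mult_2)
    also have "\<dots> = 2 ^ CARD('n) * det w" by (simp add: det_def sum_distrib_left mult_ac)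
    finally show ?thesis .
  qed
  moreover have "(\<Sum>e\<in>sign_vectors. det (mat 1 + scale_rows e w)) = 2 ^ CARD('n)"
  proof -
    have "(\<Sum>e\<in>sign_vectors. det (mat 1 + scale_rows e w))
        = (\<Sum>p | p permutes UNIV. of_int (sign p) * (\<Sum>e\<in>sign_vectors. \<Prod>i\<in>UNIV. mat 1 $ i $ p i + e i * w $ i $ p i))"
      unfolding det_def by (subst sum.swap) (simp add: scale_rows_def sum_distrib_left)
    also have "\<dots> = (\<Sum>p | p permutes UNIV. of_int (sign p) * (2 ^ CARD('n) * (\<Prod>i\<in>UNIV. (mat 1 :: complex^'n^'n) $ i $ p i)))"
      by (subst sum_sign_vectors) (simp add: prod.distrib flip: mult_2)
    also have "\<dots> = 2 ^ CARD('n) * det (mat 1 :: complex^'n^'n)" by (simp only: det_def sum_distrib_left mult_ac)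
    finally show ?thesis by simp
  qed
  ultimately show ?thesis
    by (simp add: distrib_right sum.distrib sq distrib_left)
qed

text \<open>Left multiplication by a sign matrix preserves w^T w, and the determinant as well when
  the signs multiply to one.\<close>

lemma so_ideal_scale_rows:
  assumes e: "e \<in> sign_vectors" "(\<Prod>i\<in>UNIV. e i) = 1"
  shows "so_ideal a \<Longrightarrow> so_ideal (\<lambda>w. a (scale_rows e w))"
proof (induction rule: so_ideal.induct)
  case (column p i j)
  have "e k * u * (e k * v) = u * v" for k u v
    using sign_vectors_square[OF e(1), of k] by (metis mult.assoc mult.commute mult_1)
  then have "(\<Sum>k\<in>UNIV. scale_rows e w $ k $ i * scale_rows e w $ k $ j) = (\<Sum>k\<in>UNIV. w $ k $ i * w $ k $ j)" for w
    unfolding scale_rows_def vec_lambda_beta by (simp only:)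
  moreover have "polyfun (\<lambda>w. p (scale_rows e w))"
    by (rule polyfun_compose[OF column]) (simp add: scale_rows_def, intro polyfun_intros)
  ultimately show ?case
    using so_ideal.column[of "\<lambda>w. p (scale_rows e w)" i j] by (simp only:)
next
  case (det p)
  have "polyfun (\<lambda>w. p (scale_rows e w))"
    by (rule polyfun_compose[OF det]) (simp add: scale_rows_def, intro polyfun_intros)
  from so_ideal.det[OF this] show ?case by (simp add: det_scale_rows e)
qed (rule so_ideal.add)

lemma scale_rows_ctranspose:
  assumes e: "e \<in> sign_vectors" "(\<Prod>i\<in>UNIV. e i) = 1" and y: "y \<in> special_orthogonal"
  shows "\<exists>z\<in>special_orthogonal. scale_rows e (ctranspose y) = ctranspose z"
proof -
  have re: "complex_of_real (Re (e i)) = e i" "Re (e i) * Re (e i) = 1" for i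
    using sign_vectors_cases[OF e(1), of i] by auto
  define z where "z = (\<chi> j i. Re (e i) * y $ j $ i)"
  have "scale_rows e (ctranspose y) = ctranspose z"
    by (simp add: scale_rows_def ctranspose_def z_def vec_eq_iff re)
  moreover have "transpose z ** z = mat 1"
  proof -
    have "(transpose z ** z) $ i $ j = Re (e i) * Re (e j) * (transpose y ** y) $ i $ j" for i j
      by (simp add: z_def transpose_def matrix_matrix_mult_def sum_distrib_left mult_ac)
    then show ?thesis using y re(2) by (simp add: special_orthogonal_def vec_eq_iff mat_def)
  qed
  moreover have "det z = 1"
  proof -
    have "transpose z = (\<chi> i. Re (e i) *s transpose y $ i)"
      by (simp add: z_def transpose_def vec_eq_iff)
    then have "det (transpose z) = (\<Prod>i\<in>UNIV. Re (e i)) * det (transpose y)"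
      by (simp add: det_rows_mul)
    moreover have "complex_of_real (\<Prod>i\<in>UNIV. Re (e i)) = 1"
      by (simp only: of_real_prod re e(2))
    then have "(\<Prod>i\<in>UNIV. Re (e i)) = 1" by (simp only: of_real_eq_1_iff)
    ultimately show ?thesis using y by (simp add: special_orthogonal_def)
  qed
  ultimately show ?thesis by (auto simp: special_orthogonal_def)
qed

theorem so_ideal_if_vanishes:
  fixes g :: "complex^'n^'n \<Rightarrow> complex"
  assumes g: "polyfun g" "\<And>y. y \<in> special_orthogonal \<Longrightarrow> g (ctranspose y) = 0"
  shows "so_ideal g"
proof -
  let ?a = "\<lambda>e w :: complex^'n^'n. (1 + (\<Prod>i\<in>UNIV. e i)) * det (scale_rows e (mat 1) + w)"
  have "\<exists>M. so_ideal (\<lambda>w. (\<Sum>e\<in>sign_vectors. ?a e w) ^ M * g w)"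
  proof (rule so_ideal_power_sum[OF g(1)])
    show "finite (sign_vectors :: ('n \<Rightarrow> complex) set)" by (simp add: sign_vectors_def finite_PiE)
    fix e :: "'n \<Rightarrow> complex" assume e: "e \<in> sign_vectors"
    have poly: "polyfun (?a e)"
      by (intro polyfun.mult polyfun.const polyfun_det) (simp, intro polyfun_intros)
    have "\<exists>M. so_ideal (\<lambda>w. ?a e w ^ M * g w)"
    proof (cases "(\<Prod>i\<in>UNIV. e i) = 1")
      \<comment> \<open>Such signs leave the special orthogonal group, but their weight is
        zero.\<close>
      case False
      have "(\<Prod>i\<in>UNIV. e i) * (\<Prod>i\<in>UNIV. e i) = 1"
        by (simp add: sign_vectors_square[OF e] flip: prod.distrib)
      then have "(\<Prod>i\<in>UNIV. e i) = -1" using False by (simp add: square_eq_1_iff)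
      then show ?thesis by (intro exI[of _ 1]) (simp add: so_ideal_0)
    next
      case True
      have inv: "scale_rows e (scale_rows e w) = w" for w
        by (simp add: scale_rows_def vec_eq_iff sign_vectors_square[OF e] flip: mult.assoc)
      have "polyfun (\<lambda>w. g (scale_rows e w))"
        by (rule polyfun_compose[OF g(1)]) (simp add: scale_rows_def, intro polyfun_intros)
      then obtain M where "so_ideal (\<lambda>w. cayley_det w ^ M * g (scale_rows e w))"
        using cayley_det_power_mult[of "\<lambda>w. g (scale_rows e w)"] scale_rows_ctranspose[OF e True] g(2) by metis
      from so_ideal_scale_rows[OF e True this]
      have "so_ideal (\<lambda>w. cayley_det (scale_rows e w) ^ M * g w)" by (simp add: inv)
      from so_ideal_mult[OF polyfun.const[of "2 ^ M"] this]
      have "so_ideal (\<lambda>w. (2 * cayley_det (scale_rows e w)) ^ M * g w)"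
        by (simp add: power_mult_distrib mult.assoc)
      moreover have "cayley_det (scale_rows e w) = det (scale_rows e (mat 1) + w)" for w
      proof -
        have "mat 1 + scale_rows e w = scale_rows e (scale_rows e (mat 1) + w)"
          using inv by (simp add: scale_rows_def vec_eq_iff distrib_left)
        then show ?thesis by (simp add: cayley_det_def det_scale_rows True)
      qed
      ultimately show ?thesis using True by auto
    qed
    then show "polyfun (?a e) \<and> (\<exists>M. so_ideal (\<lambda>w. ?a e w ^ M * g w))" using poly by blast
  qed
  then obtain M where M: "so_ideal (\<lambda>w. (2 ^ CARD('n) * (1 + det w)) ^ M * g w)"
    by (auto simp: sum_det_sign_vectors)
  \<comment> \<open>Modulo the ideal \<open>det w\<close> is 1, so the sum of the charts becomes a
    nonzero constant.\<close>
  have det: "so_cong (\<lambda>w :: complex^'n^'n. det w) (\<lambda>_. 1)"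
    using so_ideal_minus[OF so_ideal.det[OF polyfun.const[of 1]]]
    by (simp add: so_cong_def polyfun.const polyfun_det polyfun.coord)
  have "so_cong (\<lambda>w :: complex^'n^'n. (2 ^ CARD('n) * (1 + det w)) ^ M * g w) (\<lambda>w. (2 ^ CARD('n) * (1 + 1)) ^ M * g w)"
    by (intro so_cong_mult so_cong_power so_cong_add so_cong_refl polyfun.const g(1) det)
  with M have "so_ideal (\<lambda>w. (2 ^ CARD('n) * (1 + 1)) ^ M * g w)"
    using so_ideal_cong by blast
  then show ?thesis by (rule so_ideal_const_mult[rotated]) simp
qed

section \<open>The annihilator\<close>

lemma has_symbol_det_Dop: "has_symbol (det_Dop :: 'n::{finite, linorder} weyl) (\<lambda>w. det w)"
proof -
  have "prod_list (map f (sorted_list_of_set UNIV)) = (\<Prod>i\<in>UNIV. f i)" for f :: "'n \<Rightarrow> complex"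
    using prod.distinct_set_conv_list[of "sorted_list_of_set UNIV" f] by simp
  moreover have "has_symbol (det_Dop :: 'n weyl) (\<lambda>w. \<Sum>p | p permutes UNIV.
      of_int (sign p) * prod_list (map (\<lambda>i. w $ i $ p i) (sorted_list_of_set UNIV)))"
    unfolding det_Dop_def by (intro has_symbol_intros)
  ultimately show ?thesis by (simp add: det_def)
qed

lemma left_ideal_annihilator: "left_ideal (annihilator f)"
  by (auto simp: left_ideal_def annihilator_def weyl_apply_ring diff_ops_zero[OF weyl_apply])

theorem theorem2:
  fixes \<mu> :: "(real^'n::{finite, linorder}^'n::{finite, linorder}) measure"
  assumes "haar_probability \<mu>"
  shows "annihilator (fisher_integral \<mu>) = left_ideal hull
    ({\<Sum>k\<in>UNIV. Xop k i * Dop k j - Xop k j * Dop k i | i j. i < j}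
     \<union> {of_bool (i = j) - (\<Sum>k\<in>UNIV. Dop k i * Dop k j) | i j. i \<le> j}
     \<union> {of_bool (i = j) - (\<Sum>k\<in>UNIV. Dop i k * Dop j k) | i j. i \<le> j}
     \<union> {1 - det_Dop})"
proof -
  define G :: "'n weyl set" where "G = {\<Sum>k\<in>UNIV. Xop k i * Dop k j - Xop k j * Dop k i | i j. i < j}
     \<union> {of_bool (i = j) - (\<Sum>k\<in>UNIV. Dop k i * Dop k j) | i j. i \<le> j}
     \<union> {of_bool (i = j) - (\<Sum>k\<in>UNIV. Dop i k * Dop j k) | i j. i \<le> j}
     \<union> {1 - det_Dop}"
  define I where "I = left_ideal hull G"
  have gram: "(\<Sum>k\<in>UNIV. Xop k i * Dop k j - Xop k j * Dop k i) = gram_op i j - gram_op j i" for i j :: 'n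
    by (simp add: gram_op_def sum_subtractf)
  have G: "G = {gram_op i j - gram_op j i | i j. i < j} \<union> {column_op i j | i j. i \<le> j}
     \<union> {row_op i j | i j. i \<le> j} \<union> {1 - det_Dop}"
    unfolding G_def gram column_op_def row_op_def ..
  have det_op: "has_symbol (1 - det_Dop :: 'n weyl) (\<lambda>w. 1 - det w)"
    by (intro has_symbol_diff has_symbol_1 has_symbol_det_Dop)
  have left: "left_ideal I" unfolding I_def by (rule left_ideal_hull)
  have sub: "G \<subseteq> I" unfolding I_def by (rule hull_subset)
  interpret fisher_ideal I
  proof
    show "left_ideal I" by (rule left)
    fix i j :: 'n
    \<comment> \<open>Symmetry extends the relations listed for \<open>i \<le> j\<close> to all
      pairs.\<close>
    have "column_op i j = column_op j i"
      by (simp only: column_op_def weyl_relations(2)[of _ i _ j] eq_commute[of i j])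
    moreover have "row_op i j = row_op j i"
      by (simp only: row_op_def weyl_relations(2)[of i _ j] eq_commute[of i j])
    moreover have "i \<le> j \<Longrightarrow> column_op i j \<in> G \<and> row_op i j \<in> G" for i j
      unfolding G by blast
    ultimately show "column_op i j \<in> I" "row_op i j \<in> I"
      using sub linear[of i j] by (metis subsetD)+
    have skew: "gram_op i j - gram_op j i \<in> I" if "i < j" for i j
    proof (rule subsetD[OF sub])
      show "gram_op i j - gram_op j i \<in> G" unfolding G by (intro UnI1 CollectI exI[of _ i] exI[of _ j] conjI refl that)
    qed
    show "gram_op i j - gram_op j i \<in> I"
    proof (cases i j rule: linorder_cases)
      case greater
      from left_ideal_minus[OF left skew[OF this]] show ?thesis by simp
    qed (use skew left in \<open>auto simp: left_ideal_def\<close>)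
  qed
  \<comment> \<open>Polynomial coefficients become operators multiplied from the left, which a left
    ideal admits.\<close>
  have lift: "\<exists>s\<in>I. has_symbol s g" if "so_ideal g" for g
    using that
  proof (induction rule: so_ideal.induct)
    case (column p i j)
    obtain q where "has_symbol q p" using polyfun_symbol[OF column] by blast
    from has_symbol.mult[OF this has_symbol_column_op] show ?case
      using left column_op[of i j] unfolding left_ideal_def by blast
  next
    case (det p)
    obtain q where "has_symbol q p" using polyfun_symbol[OF det] by blast
    from has_symbol.mult[OF this det_op] show ?case
      using left sub unfolding left_ideal_def G by blast
  next
    case (add a b)
    then show ?case using left unfolding left_ideal_def by (blast intro: has_symbol.add)
  qed
  have I_sub: "I \<subseteq> annihilator (fisher_integral \<mu>)"
    unfolding I_def
  proof (rule hull_minimal[where S = left_ideal, OF _ left_ideal_annihilator])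
    have "column_op i j \<in> annihilator (fisher_integral \<mu>)" for i j
    proof (rule symbol_annihilates[OF assms has_symbol_column_op])
      show "of_bool (i = j) - (\<Sum>k\<in>UNIV. ctranspose y $ k $ i * ctranspose y $ k $ j) = 0"
        if "y \<in> special_orthogonal" for y
      proof -
        \<comment> \<open>Symbols are evaluated at transposes, so the column relation of the symbol
          is the row relation of \<open>y\<close>.\<close>
        have "(y ** transpose y) $ i $ j = mat 1 $ i $ j"
          using that by (simp add: special_orthogonal_def matrix_left_right_inverse)
        from arg_cong[OF this, of complex_of_real] show ?thesis
          by (simp add: ctranspose_def matrix_matrix_mult_def transpose_def mat_def)
      qed
    qed
    moreover have "row_op i j \<in> annihilator (fisher_integral \<mu>)" for i j
    proof (rule symbol_annihilates[OF assms has_symbol_row_op])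
      show "of_bool (i = j) - (\<Sum>k\<in>UNIV. ctranspose y $ i $ k * ctranspose y $ j $ k) = 0"
        if "y \<in> special_orthogonal" for y
      proof -
        have "(transpose y ** y) $ i $ j = mat 1 $ i $ j"
          using that by (simp add: special_orthogonal_def)
        from arg_cong[OF this, of complex_of_real] show ?thesis
          by (simp add: ctranspose_def matrix_matrix_mult_def transpose_def mat_def)
      qed
    qed
    moreover have "1 - det_Dop \<in> annihilator (fisher_integral \<mu>)"
    proof (rule symbol_annihilates[OF assms det_op])
      show "1 - det (ctranspose y) = 0" if "y \<in> special_orthogonal" for y
      proof -
        have "det (ctranspose y) = complex_of_real (det (transpose y))"
          by (simp add: ctranspose_def det_def transpose_def)
        with that show ?thesis by (simp add: special_orthogonal_def)
      qed
    qed
    ultimately show "G \<subseteq> annihilator (fisher_integral \<mu>)"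
      using gram_op_annihilates[OF assms] unfolding G by blast
  qed
  have "annihilator (fisher_integral \<mu>) \<subseteq> I"
  proof (rule subset_if_symbols_subset[OF left_ideal_annihilator I_sub])
    fix r g assume r: "has_symbol r g" "r \<in> annihilator (fisher_integral \<mu>)"
    have "so_ideal g"
      by (rule so_ideal_if_vanishes[OF has_symbol_polyfun[OF r(1)] symbol_vanishes[OF assms r]])
    then obtain s where "s \<in> I" "has_symbol s g" using lift by blast
    then show "r \<in> I" using has_symbol_inject[OF r(1)] by blast
  qed
  with I_sub show ?thesis unfolding I_def G_def by blast
qed

end
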